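(* A topological space is a $dV$-space if and only if it is homeomorphic to the upper Vietoris space $UV(L)$ of a compact regular locale $L$.
   Context: The paper's setting is choice-free: the result is intended without use of the Axiom of Choice or the Boolean Prime Ideal Theorem. Locales. A locale (frame) is a complete lattice with $a\wedge\bigvee B=\bigvee\{a\wedge b\mid b\in B\}$; $\neg a$ denotes the pseudo-complement. It is compact if $1_L=\bigvee B$ implies $1_L=\bigvee B'$ for some finite $B'\subseteq B$. Write $a\prec b$ iff $b\vee\neg a=1_L$. A compact regular locale is a compact one with $a=\bigvee\{b\mid b\prec a\}$ for all $a\in L$. The upper Vietoris space of a compact regular locale $L$ is $UV(L)=(L^-,\tau_\Box)$, where $L^-=L\setminus\{1_L\}$ and $\tau_\Box$ is generated by the sets $\Box a=\{b\in L^-\mid a\vee b=1_L\}$, $a\in L$. Topological notation. For a topological space $(X,\tau)$ and $U\subseteq X$: $\overline U$ is the closure, $U^\bot=X\setminus\overline U$, and $\mathsf{RO}(X)$ is the Boolean algebra (ordered by inclusion) of regular open sets, i.e. sets with $U^{\bot\bot}=U$. The specialization preorder is $x\le y$ iff every open set containing $x$ contains $y$. Put $\mathord{\downarrow}U=\{x\mid\exists y\in U:x\le y\}$ and $\operatorname{Int}_{\le}U=\{x\mid \forall y\ge x:\ y\in U\}$. $\mathcal{RO}(X)$ is the set of $U\subseteq X$ with $\operatorname{Int}_{\le}(\mathord{\downarrow}U)=U$. For $U,W\subseteq X$, $U\ll W$ iff $\overline U\subseteq\mathord{\downarrow}W$. $dV$-spaces. Filters are proper. A space $(X,\tau)$ is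 order-normal if for any closed set $A$ and any regular closed set $B$ with $A\cap\operatorname{Int}_{\le}B=\emptyset$ there are disjoint open sets $U,W$ with $A\subseteq\mathord{\downarrow}U$ and $\operatorname{Int}_{\le}B\subseteq W$. A $dV$-space is a topological space $(X,\tau)$ such that: (i) it is $T_0$, compact and order-normal; (ii) $\mathsf{RO}(X)$ is a basis for $\tau$ and $\mathsf{RO}(X)\subseteq\mathcal{RO}(X)$; (iii) for every $x\in X$, $\mathsf{RO}(x)=\{U\in\mathsf{RO}(X)\mid x\in U\}$ is a concordant filter on $(\mathsf{RO}(X),\ll)$ (a filter $F$ is concordant if every $U\in F$ has some $W\in F$ with $W\ll U$), and for every filter $F$ on $\mathsf{RO}(X)$ there is $x\in X$ with $\{U\in F\mid\exists W\in F: W\ll U\}=\mathsf{RO}(x)$. *)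

theory Defs
  imports "HOL-Analysis.Analysis" "HOL-Algebra.Complete_Lattice"
begin

section \<open>Compact regular locales\<close>

text \<open>
  Locales are given by a carrier and an order on it (records of HOL-Algebra), so that one can
  quantify over them. A locale whose upper Vietoris space is homeomorphic to a space \<open>X\<close> has one
  element more than \<open>X\<close>, so up to isomorphism its elements are sets of sets of points of \<open>X\<close>:
  an existential over locales may be restricted to that type. The trivial locale, in which \<open>\<bottom> = \<top>\<close>, is allowed.
\<close>

locale frame = complete_lattice L for L (structure) +
  assumes meet_Sup_distrib:
    "\<lbrakk>a \<in> carrier L; B \<subseteq> carrier L\<rbrakk> \<Longrightarrow> a \<sqinter> \<Squnion>B = \<Squnion>{a \<sqinter> b | b. b \<in> B}"

text \<open>In a frame, this supremum is the greatest element disjoint from \<open>a\<close>.\<close>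

definition pseudo_compl :: "('b, 'c) gorder_scheme \<Rightarrow> 'b \<Rightarrow> 'b" where
  "pseudo_compl L a = \<Squnion>\<^bsub>L\<^esub>{b \<in> carrier L. a \<sqinter>\<^bsub>L\<^esub> b = \<bottom>\<^bsub>L\<^esub>}"

definition well_inside :: "('b, 'c) gorder_scheme \<Rightarrow> 'b \<Rightarrow> 'b \<Rightarrow> bool" where
  "well_inside L a b \<longleftrightarrow> b \<squnion>\<^bsub>L\<^esub> pseudo_compl L a = \<top>\<^bsub>L\<^esub>"

locale compact_regular_locale = frame L for L (structure) +
  assumes compact:
    "\<lbrakk>B \<subseteq> carrier L; \<Squnion>B = \<top>\<rbrakk> \<Longrightarrow> \<exists>B'. finite B' \<and> B' \<subseteq> B \<and> \<Squnion>B' = \<top>"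
    and regular:
    "a \<in> carrier L \<Longrightarrow> a = \<Squnion>{b \<in> carrier L. well_inside L b a}"

definition box :: "('b, 'c) gorder_scheme \<Rightarrow> 'b \<Rightarrow> 'b set" where
  "box L a = {b \<in> carrier L - {\<top>\<^bsub>L\<^esub>}. a \<squnion>\<^bsub>L\<^esub> b = \<top>\<^bsub>L\<^esub>}"

text \<open>
  The underlying set of the generated topology is the union of its generators, which is
  \<open>carrier L - {\<top>} = box L \<top>\<close>.
\<close>

definition upper_Vietoris :: "('b, 'c) gorder_scheme \<Rightarrow> 'b topology" where
  "upper_Vietoris L = topology_generated_by (box L ` carrier L)"


section \<open>dV-spaces\<close>

definition perp :: "'a topology \<Rightarrow> 'a set \<Rightarrow> 'a set" where
  "perp X U = topspace X - X closure_of U"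

definition regular_opens :: "'a topology \<Rightarrow> 'a set set" where
  "regular_opens X = {U. U \<subseteq> topspace X \<and> perp X (perp X U) = U}"

definition regular_closed :: "'a topology \<Rightarrow> 'a set \<Rightarrow> bool" where
  "regular_closed X B \<longleftrightarrow> X closure_of (X interior_of B) = B"

definition spec_le :: "'a topology \<Rightarrow> 'a \<Rightarrow> 'a \<Rightarrow> bool" where
  "spec_le X x y \<longleftrightarrow> x \<in> topspace X \<and> y \<in> topspace X \<and> (\<forall>U. openin X U \<and> x \<in> U \<longrightarrow> y \<in> U)"

definition down :: "'a topology \<Rightarrow> 'a set \<Rightarrow> 'a set" where
  "down X U = {x \<in> topspace X. \<exists>y\<in>U. spec_le X x y}"

definition Int_le :: "'a topology \<Rightarrow> 'a set \<Rightarrow> 'a set" where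
  "Int_le X U = {x \<in> topspace X. \<forall>y. spec_le X x y \<longrightarrow> y \<in> U}"

text \<open>Regularity with respect to the topology of upsets of the specialization preorder.\<close>

definition order_regular_opens :: "'a topology \<Rightarrow> 'a set set" where
  "order_regular_opens X = {U. U \<subseteq> topspace X \<and> Int_le X (down X U) = U}"

definition much_below :: "'a topology \<Rightarrow> 'a set \<Rightarrow> 'a set \<Rightarrow> bool" where
  "much_below X U W \<longleftrightarrow> X closure_of U \<subseteq> down X W"

definition order_normal :: "'a topology \<Rightarrow> bool" where
  "order_normal X \<longleftrightarrow>
    (\<forall>A B. closedin X A \<and> regular_closed X B \<and> A \<inter> Int_le X B = {} \<longrightarrow>
      (\<exists>U W. openin X U \<and> openin X W \<and> U \<inter> W = {} \<and> A \<subseteq> down X U \<and> Int_le X B \<subseteq> W))"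

text \<open>
  Proper filters of the Boolean algebra of regular open sets, whose order is inclusion, whose
  least element is the empty set and whose binary meet is intersection.
\<close>

definition RO_filter :: "'a topology \<Rightarrow> 'a set set \<Rightarrow> bool" where
  "RO_filter X F \<longleftrightarrow>
    F \<subseteq> regular_opens X \<and> F \<noteq> {} \<and> {} \<notin> F \<and>
    (\<forall>U\<in>F. \<forall>W\<in>F. U \<inter> W \<in> F) \<and>
    (\<forall>U\<in>F. \<forall>W\<in>regular_opens X. U \<subseteq> W \<longrightarrow> W \<in> F)"

definition concordant_filter :: "'a topology \<Rightarrow> 'a set set \<Rightarrow> bool" where
  "concordant_filter X F \<longleftrightarrow> RO_filter X F \<and> (\<forall>U\<in>F. \<exists>W\<in>F. much_below X W U)"

definition RO_at :: "'a topology \<Rightarrow> 'a \<Rightarrow> 'a set set" where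
  "RO_at X x = {U \<in> regular_opens X. x \<in> U}"

definition dV_space :: "'a topology \<Rightarrow> bool" where
  "dV_space X \<longleftrightarrow>
    (t0_space X \<and> compact_space X \<and> order_normal X) \<and>
    (openin X = arbitrary union_of (\<lambda>U. U \<in> regular_opens X) \<and>
      regular_opens X \<subseteq> order_regular_opens X) \<and>
    ((\<forall>x\<in>topspace X. concordant_filter X (RO_at X x)) \<and>
      (\<forall>F. RO_filter X F \<longrightarrow>
        (\<exists>x\<in>topspace X. {U \<in> F. \<exists>W\<in>F. much_below X W U} = RO_at X x)))"

end

theory Submission
  imports Defs
begin

text \<open>
  In a compact regular locale \<open>L\<close> the boxes determine their generators, and
  \<open>(\<box>a)\<^sup>\<bottom> = \<box>\<not>a\<close>, so the regular open sets of \<open>UV(L)\<close> are the boxes of regular elements,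
  \<open>\<down>\<box>a = {x. \<not> a \<le> x}\<close>, and \<open>\<box>b \<lless> \<box>a\<close> holds iff \<open>b \<prec> a\<close>. A filter \<open>F\<close> of boxes is sent
  to the point \<open>\<Squnion>{\<not>b. \<box>b \<in> F}\<close>, which is not \<open>\<top>\<close> because \<open>L\<close> is compact.

  Conversely, the regular open sets of a dV-space with \<open>\<lless>\<close> satisfy the axioms of a de Vries
  algebra: order-normality gives interpolation, and
  \<open>regular_opens X \<subseteq> order_regular_opens X\<close> gives contraposition. Their round (concordant) filters, including the improper one, form a compact regular locale under
  inclusion, whose elements other than the top are exactly the filters \<open>RO(x)\<close>.
\<close>

section \<open>Compact regular locales\<close>

text \<open>The locale is recovered from the order of the space, not from its open sets. The
  specialization order of \<open>UV(L)\<close> is the order of \<open>L\<close>, so such a space is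
  \<open>L\<close> without its top. In a dV-space the points, read as filters
  \<open>RO_at X x\<close>, already carry the order of the wanted locale, namely inclusion; only the
  improper filter has to be added.

  Since every element other than \<open>\<top>\<close> is a point, separation needs no prime
  elements: a test point is written down as an element such as \<open>pc d\<close> or
  \<open>f x \<squnion> pc d\<close>, and the work lies in showing that it differs from
  \<open>\<top>\<close>. This is why \<open>\<top>\<close> keeps being split off as a separate case.

  Boxes are defined by joins equal to \<open>\<top>\<close>. For filters this means having disjoint
  members, so the box of \<open>F\<close> corresponds to the union of the sets
  \<open>perp X U\<close> with \<open>U \<in> F\<close>. Hence every passage between filters and
  open sets goes through \<open>perp\<close> and the contraposition of
  \<open>much_below\<close>.\<close>

context frame
begin

abbreviation pc :: "'a \<Rightarrow> 'a" where "pc \<equiv> pseudo_compl L"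

lemma top_join_eq [simp]: "a \<in> carrier L \<Longrightarrow> \<top> \<squnion> a = \<top>" "a \<in> carrier L \<Longrightarrow> a \<squnion> \<top> = \<top>"
  using weak.top_join[of a] by (simp_all add: join_comm eq_is_equal)

lemma top_meet_eq [simp]: "a \<in> carrier L \<Longrightarrow> \<top> \<sqinter> a = a" "a \<in> carrier L \<Longrightarrow> a \<sqinter> \<top> = a"
  using weak.top_meet[of a] by (simp_all add: meet_comm eq_is_equal)

lemma bottom_join_eq [simp]: "a \<in> carrier L \<Longrightarrow> \<bottom> \<squnion> a = a" "a \<in> carrier L \<Longrightarrow> a \<squnion> \<bottom> = a"
  using weak.bottom_join[of a] by (simp_all add: join_comm eq_is_equal)

lemma bottom_meet_eq [simp]: "a \<in> carrier L \<Longrightarrow> \<bottom> \<sqinter> a = \<bottom>" "a \<in> carrier L \<Longrightarrow> a \<sqinter> \<bottom> = \<bottom>"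
  using weak.bottom_meet[of a] by (simp_all add: meet_comm eq_is_equal)

lemma le_bottom: "\<lbrakk>a \<in> carrier L; a \<sqsubseteq> \<bottom>\<rbrakk> \<Longrightarrow> a = \<bottom>"
  by (simp add: le_antisym)

lemma top_le: "\<lbrakk>a \<in> carrier L; \<top> \<sqsubseteq> a\<rbrakk> \<Longrightarrow> a = \<top>"
  by (simp add: le_antisym)

lemma Sup_empty: "\<Squnion>{} = \<bottom>"
  using weak.weak_sup_empty by (simp add: eq_is_equal)

lemma Sup_insert: "\<lbrakk>a \<in> carrier L; A \<subseteq> carrier L\<rbrakk> \<Longrightarrow> \<Squnion>(insert a A) = a \<squnion> \<Squnion>A"
  using weak.weak_sup_insert by (simp add: eq_is_equal)

lemma Sup_mono:
  assumes "A \<subseteq> B" "B \<subseteq> carrier L" shows "\<Squnion>A \<sqsubseteq> \<Squnion>B"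
  by (meson assms order_trans subsetD sup_closed sup_least sup_upper)

lemma join_mono:
  assumes "a \<in> carrier L" "b \<in> carrier L" "c \<in> carrier L" "d \<in> carrier L" "a \<sqsubseteq> c" "b \<sqsubseteq> d"
  shows "a \<squnion> b \<sqsubseteq> c \<squnion> d"
  by (meson assms join_closed join_le join_left join_right le_trans)

lemma join_top_mono:
  assumes "a \<squnion> b = \<top>" "a \<in> carrier L" "b \<in> carrier L" "c \<in> carrier L" "d \<in> carrier L" "a \<sqsubseteq> c" "b \<sqsubseteq> d"
  shows "c \<squnion> d = \<top>"
  using join_mono[of a b c d] assms by (simp add: top_le)

lemma meet_mono:
  assumes "a \<in> carrier L" "b \<in> carrier L" "c \<in> carrier L" "d \<in> carrier L" "a \<sqsubseteq> c" "b \<sqsubseteq> d"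
  shows "a \<sqinter> b \<sqsubseteq> c \<sqinter> d"
  by (meson assms meet_closed meet_le meet_left meet_right le_trans)

lemma meet_join_distrib:
  assumes "a \<in> carrier L" "b \<in> carrier L" "c \<in> carrier L"
  shows "a \<sqinter> (b \<squnion> c) = (a \<sqinter> b) \<squnion> (a \<sqinter> c)"
proof -
  have "{a \<sqinter> x | x. x \<in> {b, c}} = {a \<sqinter> b, a \<sqinter> c}" by auto
  then show ?thesis
    using meet_Sup_distrib[of a "{b, c}"] assms by (simp add: join_def)
qed

lemma join_meet_distrib:
  assumes "a \<in> carrier L" "b \<in> carrier L" "c \<in> carrier L"
  shows "a \<squnion> (b \<sqinter> c) = (a \<squnion> b) \<sqinter> (a \<squnion> c)"
proof -
  have "(a \<squnion> b) \<sqinter> (a \<squnion> c) = ((a \<squnion> b) \<sqinter> a) \<squnion> ((a \<squnion> b) \<sqinter> c)"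
    using assms by (simp add: meet_join_distrib)
  also have "(a \<squnion> b) \<sqinter> a = a"
    using assms by (metis join_closed join_left le_iff_join meet_comm)
  also have "(a \<squnion> b) \<sqinter> c = (c \<sqinter> a) \<squnion> (c \<sqinter> b)"
    using assms by (metis meet_comm meet_join_distrib)
  also have "a \<squnion> ((c \<sqinter> a) \<squnion> (c \<sqinter> b)) = (a \<squnion> (c \<sqinter> a)) \<squnion> (c \<sqinter> b)"
    using assms by (simp add: join_assoc)
  also have "a \<squnion> (c \<sqinter> a) = a"
    using assms by (metis join_comm le_iff_meet meet_closed meet_right)
  finally show ?thesis by (metis meet_comm)
qed

lemma le_of_join_top:
  assumes "a \<in> carrier L" "b \<in> carrier L" "c \<in> carrier L" "a \<sqinter> c = \<bottom>" "b \<squnion> c = \<top>"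
  shows "a \<sqsubseteq> b"
proof -
  have "a = a \<sqinter> (b \<squnion> c)" using assms by simp
  also have "\<dots> = a \<sqinter> b" using assms(1-4) by (simp add: meet_join_distrib)
  finally show ?thesis using assms le_iff_join by simp
qed

section \<open>Pseudo-complements\<close>

lemma pc_closed [simp]: "pc a \<in> carrier L"
  unfolding pseudo_compl_def by (rule sup_closed) auto

lemma pc_greatest: "\<lbrakk>b \<in> carrier L; a \<sqinter> b = \<bottom>\<rbrakk> \<Longrightarrow> b \<sqsubseteq> pc a"
  unfolding pseudo_compl_def by (rule sup_upper) auto

text \<open>By the frame law a supremum of elements disjoint from \<open>a\<close> is still disjoint
  from \<open>a\<close>, so the supremum that defines \<open>pc a\<close> is attained.\<close>

lemma meet_pc [simp]:
  assumes "a \<in> carrier L" shows "a \<sqinter> pc a = \<bottom>" "pc a \<sqinter> a = \<bottom>"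
proof -
  let ?B = "{b \<in> carrier L. a \<sqinter> b = \<bottom>}"
  have "a \<sqinter> pc a = \<Squnion>{a \<sqinter> b | b. b \<in> ?B}"
    unfolding pseudo_compl_def using assms by (intro meet_Sup_distrib) auto
  also have "\<dots> \<sqsubseteq> \<bottom>"
    using assms by (intro sup_least) auto
  finally show "a \<sqinter> pc a = \<bottom>" using assms le_bottom by simp
  then show "pc a \<sqinter> a = \<bottom>" by (simp add: meet_comm)
qed

lemma pc_anti:
  assumes "a \<in> carrier L" "b \<in> carrier L" "a \<sqsubseteq> b" shows "pc b \<sqsubseteq> pc a"
proof (rule pc_greatest)
  have "a \<sqinter> pc b \<sqsubseteq> b \<sqinter> pc b" using assms by (intro meet_mono) auto
  then show "a \<sqinter> pc b = \<bottom>" using assms by (simp add: le_bottom)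
qed simp

lemma le_pc_pc: "a \<in> carrier L \<Longrightarrow> a \<sqsubseteq> pc (pc a)"
  by (simp add: pc_greatest)

lemma pc_pc_pc [simp]: "a \<in> carrier L \<Longrightarrow> pc (pc (pc a)) = pc a"
  by (meson le_antisym le_pc_pc pc_anti pc_closed)

lemma pc_bottom [simp]: "pc \<bottom> = \<top>"
  using pc_greatest[of \<top> \<bottom>] top_le by simp

lemma pc_top_iff: "a \<in> carrier L \<Longrightarrow> pc a = \<top> \<longleftrightarrow> a = \<bottom>"
  by (metis meet_pc(1) pc_bottom top_meet_eq(2))

lemma pc_top [simp]: "pc \<top> = \<bottom>"
  by (metis meet_pc(1) pc_closed top_closed top_meet_eq(1))

lemma pc_meet_regular:
  assumes "a \<in> carrier L" "b \<in> carrier L" "pc (pc a) = a" "pc (pc b) = b"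
  shows "pc (pc (a \<sqinter> b)) = a \<sqinter> b"
proof (rule le_antisym)
  have "pc (pc (a \<sqinter> b)) \<sqsubseteq> pc (pc a)" "pc (pc (a \<sqinter> b)) \<sqsubseteq> pc (pc b)"
    using assms(1,2) by (simp_all add: pc_anti meet_left meet_right)
  then show "pc (pc (a \<sqinter> b)) \<sqsubseteq> a \<sqinter> b" using assms by (simp add: meet_le)
qed (use assms in \<open>simp_all add: le_pc_pc\<close>)

section \<open>The well-inside relation\<close>

abbreviation wi :: "'a \<Rightarrow> 'a \<Rightarrow> bool" where "wi \<equiv> well_inside L"

lemma well_inside_le: "\<lbrakk>wi a b; a \<in> carrier L; b \<in> carrier L\<rbrakk> \<Longrightarrow> a \<sqsubseteq> b"
  unfolding well_inside_def by (rule le_of_join_top[of a b "pc a"]) simp_all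

lemma well_inside_bottom: "a \<in> carrier L \<Longrightarrow> wi \<bottom> a"
  by (simp add: well_inside_def)

text \<open>The relation sees its first argument only through \<open>pc a\<close>, and
  \<open>pc\<close> is unchanged by triple negation. Witnesses can thus be made regular, so that
  their boxes are regular open.\<close>

lemma well_inside_pc_pc: "\<lbrakk>wi a b; a \<in> carrier L\<rbrakk> \<Longrightarrow> wi (pc (pc a)) b"
  by (simp add: well_inside_def)

lemma well_inside_join:
  assumes "wi a c" "wi b c" "a \<in> carrier L" "b \<in> carrier L" "c \<in> carrier L"
  shows "wi (a \<squnion> b) c"
proof -
  have "(a \<squnion> b) \<sqinter> (pc a \<sqinter> pc b) = ((pc a \<sqinter> pc b) \<sqinter> a) \<squnion> ((pc a \<sqinter> pc b) \<sqinter> b)"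
    using assms by (metis meet_comm meet_join_distrib meet_closed pc_closed)
  also have "\<dots> = \<bottom>"
  proof -
    have "(pc a \<sqinter> pc b) \<sqinter> a \<sqsubseteq> pc a \<sqinter> a" "(pc a \<sqinter> pc b) \<sqinter> b \<sqsubseteq> pc b \<sqinter> b"
      using assms by (auto intro!: meet_mono meet_left meet_right simp del: meet_pc)
    then have "(pc a \<sqinter> pc b) \<sqinter> a = \<bottom>" "(pc a \<sqinter> pc b) \<sqinter> b = \<bottom>"
      using assms by (simp_all add: le_bottom)
    then show ?thesis by simp
  qed
  finally have le: "pc a \<sqinter> pc b \<sqsubseteq> pc (a \<squnion> b)" using assms by (simp add: pc_greatest)
  have "c \<squnion> (pc a \<sqinter> pc b) = \<top>"
    using assms by (simp add: join_meet_distrib well_inside_def)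
  then show ?thesis
    unfolding well_inside_def using assms le join_top_mono[of c "pc a \<sqinter> pc b" c "pc (a \<squnion> b)"] by simp
qed

lemma well_inside_Sup:
  assumes "finite A" "A \<subseteq> carrier L" "c \<in> carrier L" "\<And>a. a \<in> A \<Longrightarrow> wi a c"
  shows "wi (\<Squnion>A) c"
  using assms
proof (induction A)
  case empty then show ?case by (simp add: Sup_empty well_inside_bottom)
next
  case (insert a A) then show ?case by (simp add: Sup_insert well_inside_join)
qed

text \<open>Joins distribute over binary meets, and a meet is \<open>\<top>\<close> only if both
  parts are. Hence the boxes, given as a subbasis, form a basis.\<close>

lemma box_meet:
  assumes "a \<in> carrier L" "b \<in> carrier L" shows "box L (a \<sqinter> b) = box L a \<inter> box L b"
proof -
  have "(a \<sqinter> b) \<squnion> c = (a \<squnion> c) \<sqinter> (b \<squnion> c)" if "c \<in> carrier L" for c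
    using assms that join_meet_distrib[of c a b] by (simp add: join_comm)
  moreover have "c \<sqinter> d = \<top> \<longleftrightarrow> c = \<top> \<and> d = \<top>" if "c \<in> carrier L" "d \<in> carrier L" for c d
    using that by (metis meet_left meet_right top_le top_meet_eq(1))
  ultimately show ?thesis using assms by (auto simp: box_def)
qed

end

section \<open>Consequences of compactness and regularity\<close>

context compact_regular_locale
begin

lemma compact_join:
  assumes "C \<subseteq> carrier L" "x \<in> carrier L" "\<Squnion>C \<squnion> x = \<top>"
  obtains D where "finite D" "D \<subseteq> C" "\<Squnion>D \<squnion> x = \<top>"
proof -
  have "\<Squnion>(insert x C) = \<top>" using assms by (simp add: Sup_insert join_comm)
  then obtain B' where B': "finite B'" "B' \<subseteq> insert x C" "\<Squnion>B' = \<top>"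
    using compact[of "insert x C"] assms by auto
  \<comment> \<open>If \<open>x\<close> itself belongs to \<open>C\<close>, it may be dropped too:
    the join with \<open>x\<close> restores it.\<close>
  let ?D = "B' - {x}"
  have D: "?D \<subseteq> C" using B' by auto
  have "\<Squnion>B' \<sqsubseteq> \<Squnion>(insert x ?D)" using D assms by (intro Sup_mono) auto
  moreover have "\<Squnion>(insert x ?D) = \<Squnion>?D \<squnion> x"
    using Sup_insert[of x ?D] D assms by (metis join_comm order_trans)
  moreover have "\<Squnion>?D \<in> carrier L" using D assms by (intro sup_closed) auto
  ultimately have "\<Squnion>?D \<squnion> x = \<top>"
    using B'(3) assms(2) by (metis join_closed top_le)
  then show ?thesis using that B' D by blast
qed

text \<open>Regularity writes \<open>a\<close> as a supremum, compactness keeps finitely many of its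
  terms, and their join stays well inside \<open>a\<close>. For \<open>x = pc c\<close> this is
  interpolation between \<open>c\<close> and \<open>a\<close>; the general form also serves for
  points \<open>x\<close>.\<close>

lemma well_inside_interpolate_join:
  assumes "a \<in> carrier L" "x \<in> carrier L" "a \<squnion> x = \<top>"
  obtains b where "b \<in> carrier L" "wi b a" "b \<squnion> x = \<top>"
proof -
  let ?C = "{b \<in> carrier L. wi b a}"
  have "\<Squnion>?C \<squnion> x = \<top>" using regular assms by simp
  then obtain D where D: "finite D" "D \<subseteq> ?C" "\<Squnion>D \<squnion> x = \<top>"
    using compact_join[of ?C x] assms by auto
  moreover have "wi (\<Squnion>D) a" using D assms by (intro well_inside_Sup) auto
  moreover have "\<Squnion>D \<in> carrier L" using D by (intro sup_closed) auto
  ultimately show ?thesis using that by blast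
qed

text \<open>Regularity by contraposition. Its witness \<open>b\<close> yields the test points that
  separate elements and points.\<close>

lemma not_le_well_inside:
  assumes "a \<in> carrier L" "x \<in> carrier L" "\<not> a \<sqsubseteq> x"
  obtains b where "b \<in> carrier L" "wi b a" "\<not> b \<sqsubseteq> x"
proof -
  have "\<exists>b\<in>{b \<in> carrier L. wi b a}. \<not> b \<sqsubseteq> x"
  proof (rule ccontr)
    assume "\<not> ?thesis"
    then have "\<Squnion>{b \<in> carrier L. wi b a} \<sqsubseteq> x" using assms by (intro sup_least) auto
    then show False using assms regular by simp
  qed
  then show ?thesis using that by auto
qed

end

section \<open>Regular open sets\<close>

lemma perp_iff: "x \<in> perp X S \<longleftrightarrow> (\<exists>V. openin X V \<and> x \<in> V \<and> V \<inter> S = {})"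
proof -
  have "x \<in> V \<Longrightarrow> openin X V \<Longrightarrow> x \<in> topspace X" for V using openin_subset by blast
  then show ?thesis by (simp add: perp_def in_closure_of) blast
qed

lemma openin_perp [simp]: "openin X (perp X S)"
  unfolding perp_def by (simp add: openin_diff)

lemma perp_anti: "S \<subseteq> T \<Longrightarrow> perp X T \<subseteq> perp X S"
  unfolding subset_iff perp_iff by blast

lemma regular_open_openin: "U \<in> regular_opens X \<Longrightarrow> openin X U"
  using openin_perp[of X "perp X U"] by (simp add: regular_opens_def)

lemma regular_open_perp_perp: "U \<in> regular_opens X \<Longrightarrow> perp X (perp X U) = U"
  by (simp add: regular_opens_def)

text \<open>Complements exchange closure and interior. Order-normality is stated with regular closed
  sets, and this translates it to regular open ones.\<close>

lemma regular_closed_iff: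
  "regular_closed X B \<longleftrightarrow> B \<subseteq> topspace X \<and> topspace X - B \<in> regular_opens X"
proof -
  have "perp X (topspace X - B) = X interior_of B"
    by (simp add: perp_def interior_of_closure_of)
  moreover have "X closure_of (X interior_of B) \<subseteq> topspace X" by (rule closure_of_subset_topspace)
  ultimately show ?thesis
    unfolding regular_closed_def regular_opens_def perp_def by auto
qed

lemma Int_le_eq: "Int_le X B = topspace X - down X (topspace X - B)"
  by (auto simp: Int_le_def down_def spec_le_def)

lemma perp_subset_topspace: "perp X S \<subseteq> topspace X" by (auto simp: perp_def)

lemma disjoint_perp: "S \<inter> perp X S = {}"
  by (auto simp: perp_iff)

lemma subset_perp: "\<lbrakk>openin X V; V \<inter> S = {}\<rbrakk> \<Longrightarrow> V \<subseteq> perp X S"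
  by (auto simp: perp_iff)

lemma subset_perp_perp: "openin X U \<Longrightarrow> U \<subseteq> perp X (perp X U)"
  using disjoint_perp by (intro subset_perp)

lemma perp_regular: "openin X U \<Longrightarrow> perp X U \<in> regular_opens X"
  by (simp add: regular_opens_def perp_subset_topspace perp_anti subset_perp_perp subset_antisym)

lemma perp_topspace [simp]: "perp X (topspace X) = {}"
  by (simp add: perp_def)

lemma perp_empty [simp]: "perp X {} = topspace X"
  by (simp add: perp_def)

lemma topspace_regular [simp]: "topspace X \<in> regular_opens X"
  and empty_regular [simp]: "{} \<in> regular_opens X"
  by (simp_all add: regular_opens_def)

lemma regular_open_subset: "U \<in> regular_opens X \<Longrightarrow> U \<subseteq> topspace X"
  by (simp add: regular_opens_def)

lemma closure_of_eq_perp: "U \<subseteq> topspace X \<Longrightarrow> X closure_of U = topspace X - perp X U"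
  using closure_of_subset_topspace[of X U] by (auto simp: perp_def)

lemma Int_regular:
  assumes "U \<in> regular_opens X" "W \<in> regular_opens X" shows "U \<inter> W \<in> regular_opens X"
proof -
  have "perp X (perp X (U \<inter> W)) \<subseteq> perp X (perp X U)" "perp X (perp X (U \<inter> W)) \<subseteq> perp X (perp X W)"
    by (simp_all add: perp_anti)
  then have "perp X (perp X (U \<inter> W)) \<subseteq> U \<inter> W" using assms by (simp add: regular_open_perp_perp)
  moreover have "U \<inter> W \<subseteq> perp X (perp X (U \<inter> W))"
    using assms by (intro subset_perp_perp openin_Int regular_open_openin)
  ultimately show ?thesis using assms by (auto simp: regular_opens_def)
qed

lemma Inter_regular:
  assumes "finite T" "T \<subseteq> regular_opens X" shows "topspace X \<inter> \<Inter>T \<in> regular_opens X"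
  using assms
proof (induction T)
  case (insert U T)
  then have "U \<inter> (topspace X \<inter> \<Inter>T) \<in> regular_opens X" by (rule_tac Int_regular) auto
  moreover have "U \<inter> (topspace X \<inter> \<Inter>T) = topspace X \<inter> \<Inter>(insert U T)" by auto
  ultimately show ?case by simp
qed simp

section \<open>Upper Vietoris spaces are dV-spaces\<close>

text \<open>
  Working along a homeomorphism \<open>f\<close> from the start avoids transporting each axiom of a dV-space.
\<close>

locale Vietoris_model = compact_regular_locale L for L (structure) +
  fixes X :: "'c topology" and f :: "'c \<Rightarrow> 'a"
  assumes f_bij: "bij_betw f (topspace X) (carrier L - {\<top>})"
    and openin_iff_box: "openin X U \<longleftrightarrow> U \<subseteq> topspace X \<and>
      (\<forall>x\<in>U. \<exists>a\<in>carrier L. f x \<in> box L a \<and> topspace X \<inter> f -` box L a \<subseteq> U)"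
begin

section \<open>Boxes and the specialization order\<close>

definition bx :: "'a \<Rightarrow> 'c set" where "bx a = {x \<in> topspace X. a \<squnion> f x = \<top>}"

lemma f_closed [simp]: "x \<in> topspace X \<Longrightarrow> f x \<in> carrier L" "x \<in> topspace X \<Longrightarrow> f x \<noteq> \<top>"
  using f_bij by (auto simp: bij_betw_def)

lemma f_surj: "\<lbrakk>c \<in> carrier L; c \<noteq> \<top>\<rbrakk> \<Longrightarrow> \<exists>x\<in>topspace X. f x = c"
proof -
  assume "c \<in> carrier L" "c \<noteq> \<top>"
  then have "c \<in> f ` topspace X" using f_bij by (simp add: bij_betw_def)
  then show ?thesis by auto
qed

lemma bx_eq_vimage: "bx a = topspace X \<inter> f -` box L a"
  by (auto simp: box_def bx_def)

lemma openin_iff: "openin X U \<longleftrightarrow> U \<subseteq> topspace X \<and> (\<forall>x\<in>U. \<exists>a\<in>carrier L. x \<in> bx a \<and> bx a \<subseteq> U)"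
proof -
  have "f x \<in> box L a \<longleftrightarrow> x \<in> bx a" if "x \<in> topspace X" for a x
    using that by (auto simp: box_def bx_def)
  then show ?thesis unfolding openin_iff_box bx_eq_vimage by (simp add: subset_iff cong: conj_cong)
qed

lemma openin_bx: "a \<in> carrier L \<Longrightarrow> openin X (bx a)"
  unfolding openin_iff by (auto simp: bx_def)

lemma bx_subset_topspace: "bx a \<subseteq> topspace X" by (auto simp: bx_def)

lemma bx_upward:
  assumes "x \<in> bx a" "a \<in> carrier L" "y \<in> topspace X" "f x \<sqsubseteq> f y"
  shows "y \<in> bx a"
  using assms join_top_mono[of a "f x" a "f y"] by (auto simp: bx_def)

lemma bx_mono: "\<lbrakk>a \<in> carrier L; b \<in> carrier L; a \<sqsubseteq> b\<rbrakk> \<Longrightarrow> bx a \<subseteq> bx b"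
  using join_top_mono[of a _ b] by (auto simp: bx_def)

lemma bx_top [simp]: "bx \<top> = topspace X" and bx_bottom [simp]: "bx \<bottom> = {}"
  by (auto simp: bx_def)

lemma bx_meet: "\<lbrakk>a \<in> carrier L; b \<in> carrier L\<rbrakk> \<Longrightarrow> bx (a \<sqinter> b) = bx a \<inter> bx b"
  using box_meet[of a b] by (auto simp: bx_eq_vimage)

text \<open>If \<open>d\<close> is well inside \<open>a\<close> but not below \<open>b\<close>, then
  \<open>pc d\<close> is a point in the box of \<open>a\<close>. It cannot lie in the box of
  \<open>b\<close>, for that would put \<open>d\<close> well inside \<open>b\<close>.\<close>

lemma le_of_bx_subset:
  assumes "a \<in> carrier L" "b \<in> carrier L" "bx a \<subseteq> bx b"
  shows "a \<sqsubseteq> b"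
proof (rule ccontr)
  assume "\<not> a \<sqsubseteq> b"
  then obtain d where d: "d \<in> carrier L" "wi d a" "\<not> d \<sqsubseteq> b"
    using not_le_well_inside assms by blast
  then have "pc d \<noteq> \<top>" using assms(2) by (metis bottom_lower pc_top_iff)
  then obtain x where x: "x \<in> topspace X" "f x = pc d" using f_surj[of "pc d"] by auto
  then have "x \<in> bx a" using d by (simp add: bx_def well_inside_def)
  then have "wi d b" using assms x by (auto simp: bx_def well_inside_def)
  then show False using well_inside_le d assms by blast
qed

lemma bx_eq_iff: "\<lbrakk>a \<in> carrier L; b \<in> carrier L\<rbrakk> \<Longrightarrow> bx a = bx b \<longleftrightarrow> a = b"
  by (metis le_antisym le_of_bx_subset order_refl)

lemma bx_empty_iff: "a \<in> carrier L \<Longrightarrow> bx a = {} \<longleftrightarrow> a = \<bottom>"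
  using bx_eq_iff[of a \<bottom>] by simp

text \<open>If \<open>b\<close> is well inside \<open>f x\<close> but not below \<open>f y\<close>,
  the box of \<open>pc b\<close> contains \<open>x\<close> and not \<open>y\<close>. Conversely,
  boxes are upward closed.\<close>

lemma spec_le_iff: "spec_le X x y \<longleftrightarrow> x \<in> topspace X \<and> y \<in> topspace X \<and> f x \<sqsubseteq> f y"
proof (cases "x \<in> topspace X \<and> y \<in> topspace X")
  case True
  have "f x \<sqsubseteq> f y" if "spec_le X x y"
  proof (rule ccontr)
    assume "\<not> f x \<sqsubseteq> f y"
    then obtain b where b: "b \<in> carrier L" "wi b (f x)" "\<not> b \<sqsubseteq> f y"
      using not_le_well_inside True f_closed by metis
    then have "x \<in> bx (pc b)" using True by (simp add: bx_def well_inside_def join_comm)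
    then have "y \<in> bx (pc b)" using that by (simp add: spec_le_def openin_bx)
    then have "wi b (f y)" by (simp add: bx_def well_inside_def join_comm)
    then show False using well_inside_le b True by simp
  qed
  moreover have "spec_le X x y" if "f x \<sqsubseteq> f y"
    unfolding spec_le_def using that True openin_iff bx_upward by (meson subsetD)
  ultimately show ?thesis using True by blast
qed (auto simp: spec_le_def)

text \<open>Boxes do not in general turn suprema into unions, but \<open>perp\<close> cannot tell
  the difference: a box missing every \<open>bx a\<close> belongs to an element disjoint from each
  \<open>a\<close>, hence, by the frame law, from \<open>\<Squnion>A\<close>. So the
  \<open>perp\<close> of any open set is a box.\<close>

lemma perp_Union_bx:
  assumes "A \<subseteq> carrier L"
  shows "perp X (\<Union>a\<in>A. bx a) = bx (pc (\<Squnion>A))"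
proof (intro Set.set_eqI iffI)
  have sA [simp]: "\<Squnion>A \<in> carrier L" using assms by simp
  fix x assume "x \<in> perp X (\<Union>a\<in>A. bx a)"
  then obtain V where "openin X V" "x \<in> V" "V \<inter> (\<Union>a\<in>A. bx a) = {}" by (auto simp: perp_iff)
  moreover from this obtain b where "b \<in> carrier L" "x \<in> bx b" "bx b \<subseteq> V"
    by (auto simp: openin_iff)
  ultimately have b: "b \<in> carrier L" "x \<in> bx b" "\<And>a. a \<in> A \<Longrightarrow> bx b \<inter> bx a = {}"
    by auto
  have "b \<sqinter> a = \<bottom>" if "a \<in> A" for a
  proof -
    have "a \<in> carrier L" using that assms by auto
    then show ?thesis using b(1) b(3)[OF that] bx_meet bx_empty_iff[of "b \<sqinter> a"] by simp
  qed
  then have "\<Squnion>{b \<sqinter> a | a. a \<in> A} \<sqsubseteq> \<bottom>" by (intro sup_least) auto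
  then have "b \<sqinter> \<Squnion>A \<sqsubseteq> \<bottom>" using meet_Sup_distrib[of b A] b(1) assms by simp
  then have "b \<sqinter> \<Squnion>A = \<bottom>" using b(1) by (simp add: le_bottom)
  then have "\<Squnion>A \<sqinter> b = \<bottom>" by (simp add: meet_comm)
  then have "b \<sqsubseteq> pc (\<Squnion>A)" using b pc_greatest by simp
  then show "x \<in> bx (pc (\<Squnion>A))" using bx_mono[of b "pc (\<Squnion>A)"] b(1,2) by auto
next
  have sA [simp]: "\<Squnion>A \<in> carrier L" using assms by simp
  fix x assume x: "x \<in> bx (pc (\<Squnion>A))"
  have "bx (pc (\<Squnion>A)) \<inter> bx a = {}" if "a \<in> A" for a
  proof -
    have "bx (pc (\<Squnion>A)) \<inter> bx a \<subseteq> bx (pc (\<Squnion>A)) \<inter> bx (\<Squnion>A)"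
      using that assms bx_mono[of a "\<Squnion>A"] sup_upper by auto
    also have "\<dots> = bx (pc (\<Squnion>A) \<sqinter> \<Squnion>A)" using bx_meet[of "pc (\<Squnion>A)" "\<Squnion>A"] by simp
    also have "\<dots> = {}" by simp
    finally show ?thesis by simp
  qed
  then show "x \<in> perp X (\<Union>a\<in>A. bx a)"
    unfolding perp_iff using x openin_bx[OF pc_closed, of "\<Squnion>A"] by (intro exI[of _ "bx (pc (\<Squnion>A))"]) auto
qed

lemma perp_bx: "a \<in> carrier L \<Longrightarrow> perp X (bx a) = bx (pc a)"
  using perp_Union_bx[of "{a}"] by simp

lemma regular_opens_eq: "regular_opens X = {bx a | a. a \<in> carrier L \<and> pc (pc a) = a}"
proof (intro Set.set_eqI iffI)
  fix U assume U: "U \<in> regular_opens X"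
  let ?A = "{a \<in> carrier L. bx a \<subseteq> U}"
  have "U = (\<Union>a\<in>?A. bx a)"
    using regular_open_openin[OF U] by (auto simp: openin_iff)
  then have "perp X U = bx (pc (\<Squnion>?A))" using perp_Union_bx[of ?A] by auto
  then have "U = bx (pc (pc (\<Squnion>?A)))" using regular_open_perp_perp[OF U] perp_bx by simp
  moreover have "\<Squnion>?A \<in> carrier L" by (rule sup_closed) auto
  ultimately show "U \<in> {bx a | a. a \<in> carrier L \<and> pc (pc a) = a}"
    by (intro CollectI exI[of _ "pc (pc (\<Squnion>?A))"]) simp
next
  fix U assume "U \<in> {bx a | a. a \<in> carrier L \<and> pc (pc a) = a}"
  then show "U \<in> regular_opens X"
    using bx_subset_topspace by (auto simp: regular_opens_def perp_bx)
qed

lemma bx_regular: "\<lbrakk>a \<in> carrier L; pc (pc a) = a\<rbrakk> \<Longrightarrow> bx a \<in> regular_opens X"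
  unfolding regular_opens_eq by blast

lemma down_bx:
  assumes "a \<in> carrier L"
  shows "down X (bx a) = {x \<in> topspace X. \<not> a \<sqsubseteq> f x}"
proof (intro Set.set_eqI iffI)
  fix x assume "x \<in> down X (bx a)"
  then obtain y where y: "x \<in> topspace X" "y \<in> topspace X" "f x \<sqsubseteq> f y" "a \<squnion> f y = \<top>"
    by (auto simp: down_def spec_le_iff bx_def)
  have "a \<sqsubseteq> f y" if "a \<sqsubseteq> f x"
    using that y assms by (meson f_closed(1) le_trans)
  then show "x \<in> {x \<in> topspace X. \<not> a \<sqsubseteq> f x}"
    using y assms le_iff_meet[of a "f y"] f_closed(2)[of y] by (auto simp del: f_closed(2))
next
  fix x assume x: "x \<in> {x \<in> topspace X. \<not> a \<sqsubseteq> f x}"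
  then obtain d where d: "d \<in> carrier L" "wi d a" "\<not> d \<sqsubseteq> f x"
    using not_le_well_inside[of a "f x"] assms by auto
  \<comment> \<open>This element is a point: were it \<open>\<top>\<close>, then \<open>d\<close>
    would be well inside \<open>f x\<close>. It lies above \<open>f x\<close>, and its part
    \<open>pc d\<close> puts it into the box of \<open>a\<close>.\<close>
  let ?c = "f x \<squnion> pc d"
  have "?c \<noteq> \<top>" using d x well_inside_le[of d "f x"] by (auto simp: well_inside_def)
  then obtain y where y: "y \<in> topspace X" "f y = ?c" using f_surj[of ?c] x by auto
  have "a \<squnion> f y = \<top>"
    using join_top_mono[of a "pc d" a ?c] d x y assms by (auto simp: well_inside_def join_right)
  moreover have "f x \<sqsubseteq> f y" using x y by (simp add: join_left)
  ultimately show "x \<in> down X (bx a)" using x y by (auto simp: down_def spec_le_iff bx_def)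
qed

lemma closure_of_bx: "a \<in> carrier L \<Longrightarrow> X closure_of bx a = topspace X - bx (pc a)"
  using perp_bx[of a] closure_of_subset_topspace[of X "bx a"] unfolding perp_def by blast

lemma much_below_bx:
  assumes "a \<in> carrier L" "b \<in> carrier L"
  shows "much_below X (bx b) (bx a) \<longleftrightarrow> wi b a"
proof
  assume mb: "much_below X (bx b) (bx a)"
  show "wi b a"
  \<comment> \<open>The element \<open>a\<close> itself serves as test point: it lies outside
    \<open>down X (bx a)\<close>, hence in \<open>bx (pc b)\<close>. Only \<open>\<top>\<close> is
    not a point.\<close>
  proof (cases "a = \<top>")
    case False
    then obtain x where x: "x \<in> topspace X" "f x = a" using assms f_surj by blast
    then have "x \<notin> down X (bx a)" using assms by (simp add: down_bx)
    then have "x \<in> bx (pc b)"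
      using mb x assms by (auto simp: much_below_def closure_of_bx)
    then show ?thesis using x by (simp add: bx_def well_inside_def join_comm)
  qed (simp add: well_inside_def)
next
  assume wi: "wi b a"
  have "x \<in> bx (pc b)" if "x \<in> topspace X" "a \<sqsubseteq> f x" for x
    using join_top_mono[of "pc b" a "pc b" "f x"] wi that assms
    by (simp add: bx_def well_inside_def join_comm)
  then show "much_below X (bx b) (bx a)"
    using assms by (auto simp: much_below_def closure_of_bx down_bx)
qed

text \<open>Double negation makes the interpolant regular. This gives both the basis of regular open
  sets and the concordance of \<open>RO_at X x\<close>.\<close>

lemma bx_interpolate:
  assumes "a \<in> carrier L" "x \<in> bx a"
  obtains b where "b \<in> carrier L" "pc (pc b) = b" "wi b a" "x \<in> bx b"
proof -
  obtain b where b: "b \<in> carrier L" "wi b a" "b \<squnion> f x = \<top>"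
    using well_inside_interpolate_join[of a "f x"] assms by (auto simp: bx_def)
  have "x \<in> bx (pc (pc b))"
    using b assms(2) bx_mono[of b "pc (pc b)"] le_pc_pc by (auto simp: bx_def)
  then show ?thesis using that[of "pc (pc b)"] b well_inside_pc_pc by simp
qed

section \<open>The axioms of a dV-space\<close>

lemma t0_space_X: "t0_space X"
  unfolding t0_space_def
proof (intro ballI impI)
  fix x y assume xy: "x \<in> topspace X" "y \<in> topspace X" "x \<noteq> y"
  then have "f x \<noteq> f y" using f_bij by (auto simp: bij_betw_def inj_on_def)
  then have "\<not> f x \<sqsubseteq> f y \<or> \<not> f y \<sqsubseteq> f x" using xy le_antisym[of "f x" "f y"] by auto
  then have "\<not> spec_le X x y \<or> \<not> spec_le X y x" by (simp add: spec_le_iff xy)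
  then show "\<exists>U. openin X U \<and> (x \<notin> U \<longleftrightarrow> y \<in> U)" using xy by (auto simp: spec_le_def)
qed

lemma openin_upward: "\<lbrakk>openin X U; x \<in> U; y \<in> topspace X; f x \<sqsubseteq> f y\<rbrakk> \<Longrightarrow> y \<in> U"
  using openin_subset[of X U] spec_le_iff[of x y] by (auto simp: spec_le_def)

text \<open>Open sets are upward closed, so a member of the cover that contains the least point
  \<open>\<bottom>\<close> is already the whole space. If there is any point at all,
  \<open>\<bottom>\<close> is one.\<close>

lemma compact_space_X: "compact_space X"
  unfolding compact_space_alt
proof (intro allI impI)
  fix \<U> assume U: "(\<forall>U\<in>\<U>. openin X U) \<and> topspace X \<subseteq> \<Union>\<U>"
  show "\<exists>\<F>. finite \<F> \<and> \<F> \<subseteq> \<U> \<and> topspace X \<subseteq> \<Union>\<F>"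
  proof (cases "topspace X = {}")
    case False
    then obtain z where z: "z \<in> topspace X" by blast
    have "\<bottom> \<noteq> \<top>"
    proof
      assume "\<bottom> = \<top>"
      then have "\<top> \<sqsubseteq> f z" using bottom_lower[of "f z"] z by simp
      then show False using top_le[of "f z"] z by simp
    qed
    then obtain x where x: "x \<in> topspace X" "f x = \<bottom>" using f_surj[of \<bottom>] by auto
    then obtain U0 where U0: "U0 \<in> \<U>" "x \<in> U0" using U by blast
    have "y \<in> U0" if "y \<in> topspace X" for y
      by (rule openin_upward[of U0 x]) (use U U0 x that in auto)
    then show ?thesis using U0 by (intro exI[of _ "{U0}"]) auto
  qed auto
qed

text \<open>\<open>Int_le X B\<close> consists of the points above one element \<open>b\<close>, so
  only the point \<open>b\<close> has to be separated from \<open>A\<close>. A box of some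
  \<open>a\<close> around it misses \<open>A\<close>, and an \<open>e\<close> well inside
  \<open>a\<close> with \<open>e \<squnion> b = \<top>\<close> gives the disjoint boxes of
  \<open>pc e\<close> and \<open>e\<close>.\<close>

lemma order_normal_X: "order_normal X"
  unfolding order_normal_def
proof (intro allI impI)
  fix A B assume H: "closedin X A \<and> regular_closed X B \<and> A \<inter> Int_le X B = {}"
  then obtain b where b: "b \<in> carrier L" "topspace X - B = bx b"
    unfolding regular_closed_iff regular_opens_eq by auto
  have IB: "Int_le X B = {x \<in> topspace X. b \<sqsubseteq> f x}"
    unfolding Int_le_eq b(2) using b by (auto simp: down_bx)
  show "\<exists>U W. openin X U \<and> openin X W \<and> U \<inter> W = {} \<and> A \<subseteq> down X U \<and> Int_le X B \<subseteq> W"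
  proof (cases "b = \<top>")
    case True
    have "x \<notin> Int_le X B" for x
      using f_closed(1)[of x] f_closed(2)[of x] top_le[of "f x"] unfolding IB True by blast
    moreover have "A \<subseteq> down X (topspace X)"
      using H closedin_subset[of X A] by (auto simp: down_def spec_le_def)
    ultimately show ?thesis by (intro exI[of _ "topspace X"] exI[of _ "{}"]) auto
  next
    case False
    then obtain x where x: "x \<in> topspace X" "f x = b" using f_surj b by auto
    then have "x \<in> topspace X - A" using H b IB by auto
    moreover have "openin X (topspace X - A)" using H by auto
    ultimately obtain a where a: "a \<in> carrier L" "x \<in> bx a" "bx a \<subseteq> topspace X - A"
      by (auto simp: openin_iff)
    obtain e where e: "e \<in> carrier L" "wi e a" "e \<squnion> b = \<top>"
      using well_inside_interpolate_join[of a b] a b x by (auto simp: bx_def)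
    have "bx (pc e) \<inter> bx e = bx (pc e \<sqinter> e)" using bx_meet[of "pc e" e] e by simp
    then have "bx (pc e) \<inter> bx e = {}" using e by simp
    moreover have "A \<subseteq> down X (bx (pc e))"
    proof
      fix y assume y: "y \<in> A"
      then have yX: "y \<in> topspace X" using H closedin_subset[of X A] by auto
      have "\<not> pc e \<sqsubseteq> f y"
      proof
        assume "pc e \<sqsubseteq> f y"
        then have "y \<in> bx a"
          using join_top_mono[of a "pc e" a "f y"] a e yX by (auto simp: bx_def well_inside_def)
        then show False using a y by auto
      qed
      then show "y \<in> down X (bx (pc e))" using yX by (simp add: down_bx)
    qed
    moreover have "y \<in> bx e" if "y \<in> topspace X" "b \<sqsubseteq> f y" for y
      using join_top_mono[of e b e "f y"] that b e by (auto simp: bx_def)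
    then have "Int_le X B \<subseteq> bx e" unfolding IB by auto
    ultimately show ?thesis using openin_bx e by (intro exI[of _ "bx (pc e)"] exI[of _ "bx e"]) auto
  qed
qed

lemma regular_open_basis: "openin X = arbitrary union_of (\<lambda>U. U \<in> regular_opens X)"
proof (rule ext, rule iffI)
  fix U assume U: "openin X U"
  have "\<exists>V\<in>regular_opens X. x \<in> V \<and> V \<subseteq> U" if xU: "x \<in> U" for x
  proof -
    from U xU obtain a where a: "a \<in> carrier L" "x \<in> bx a" "bx a \<subseteq> U" by (auto simp: openin_iff)
    then obtain b where b: "b \<in> carrier L" "pc (pc b) = b" "wi b a" "x \<in> bx b"
      using bx_interpolate by blast
    then have "bx b \<subseteq> U" using a bx_mono[of b a] well_inside_le by auto
    then show ?thesis using b bx_regular by blast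
  qed
  then have "\<Union>{V \<in> regular_opens X. V \<subseteq> U} = U" by blast
  then show "(arbitrary union_of (\<lambda>U. U \<in> regular_opens X)) U"
    unfolding union_of_def arbitrary_def by (intro exI[of _ "{V \<in> regular_opens X. V \<subseteq> U}"]) auto
next
  fix U assume "(arbitrary union_of (\<lambda>U. U \<in> regular_opens X)) U"
  then show "openin X U" unfolding union_of_def using regular_open_openin by (auto intro: openin_Union)
qed

lemma regular_opens_order_regular: "regular_opens X \<subseteq> order_regular_opens X"
proof
  fix U assume U: "U \<in> regular_opens X"
  then obtain a where a: "a \<in> carrier L" "U = bx a" by (auto simp: regular_opens_eq)
  have "Int_le X (down X (bx a)) = bx a"
  proof (intro Set.set_eqI iffI)
    fix x assume "x \<in> bx a"
    then show "x \<in> Int_le X (down X (bx a))"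
      using bx_upward[of x a] a by (auto simp: Int_le_def spec_le_iff down_def bx_def)
  next
    fix x assume x: "x \<in> Int_le X (down X (bx a))"
    then have xX: "x \<in> topspace X" by (simp add: Int_le_def)
    have "a \<squnion> f x = \<top>"
    proof (rule ccontr)
      assume "a \<squnion> f x \<noteq> \<top>"
      \<comment> \<open>A join different from \<open>\<top>\<close> would be a point above
        \<open>x\<close>, and, being above \<open>a\<close>, one outside
        \<open>down X (bx a)\<close>.\<close>
      then obtain y where y: "y \<in> topspace X" "f y = a \<squnion> f x" using f_surj[of "a \<squnion> f x"] a xX by auto
      then have "spec_le X x y" using xX a by (simp add: spec_le_iff join_right)
      then have "y \<in> down X (bx a)" using x by (simp add: Int_le_def)
      then show False using y a xX by (simp add: down_bx join_left)
    qed
    then show "x \<in> bx a" using xX by (simp add: bx_def)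
  qed
  then show "U \<in> order_regular_opens X" using a bx_subset_topspace by (simp add: order_regular_opens_def)
qed

lemma RO_at_concordant:
  assumes x: "x \<in> topspace X"
  shows "concordant_filter X (RO_at X x)"
proof -
  have "\<exists>W\<in>RO_at X x. much_below X W U" if "U \<in> RO_at X x" for U
  proof -
    from that obtain a where a: "a \<in> carrier L" "U = bx a" "x \<in> bx a"
      by (auto simp: RO_at_def regular_opens_eq)
    then obtain b where "b \<in> carrier L" "pc (pc b) = b" "wi b a" "x \<in> bx b"
      using bx_interpolate by blast
    then show ?thesis using a bx_regular by (intro bexI[of _ "bx b"]) (auto simp: much_below_bx RO_at_def)
  qed
  moreover have "U \<inter> W \<in> RO_at X x" if "U \<in> RO_at X x" "W \<in> RO_at X x" for U W
  proof -
    from that obtain a b where "a \<in> carrier L" "U = bx a" "pc (pc a) = a" "b \<in> carrier L" "W = bx b" "pc (pc b) = b"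
      by (auto simp: RO_at_def regular_opens_eq)
    then have "U \<inter> W \<in> regular_opens X"
      using bx_regular[of "a \<sqinter> b"] by (simp add: bx_meet pc_meet_regular)
    then show ?thesis using that by (simp add: RO_at_def)
  qed
  moreover have "topspace X \<in> RO_at X x"
    using bx_regular[of \<top>] x by (simp add: RO_at_def)
  moreover have "W \<in> RO_at X x" if "U \<in> RO_at X x" "W \<in> regular_opens X" "U \<subseteq> W" for U W
    using that by (auto simp: RO_at_def)
  moreover have "RO_at X x \<subseteq> regular_opens X" "{} \<notin> RO_at X x" by (auto simp: RO_at_def)
  ultimately show ?thesis
    unfolding concordant_filter_def RO_filter_def by (intro conjI ballI impI) blast+
qed

lemma round_part_RO_at:
  assumes F: "RO_filter X F"
  shows "\<exists>x\<in>topspace X. {U \<in> F. \<exists>W\<in>F. much_below X W U} = RO_at X x"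
proof -
  let ?G = "{a \<in> carrier L. pc (pc a) = a \<and> bx a \<in> F}"
  let ?C = "pc ` ?G"
  have FR: "F \<subseteq> regular_opens X" and ne: "F \<noteq> {}" and emp: "{} \<notin> F"
    and int: "\<And>U W. U \<in> F \<Longrightarrow> W \<in> F \<Longrightarrow> U \<inter> W \<in> F"
    and up: "\<And>U W. U \<in> F \<Longrightarrow> W \<in> regular_opens X \<Longrightarrow> U \<subseteq> W \<Longrightarrow> W \<in> F"
    using F unfolding RO_filter_def by blast+
  have top: "\<top> \<in> ?G"
  proof -
    obtain U where "U \<in> F" using ne by blast
    moreover from this have "U \<subseteq> topspace X" using FR by (auto simp: regular_opens_def)
    ultimately have "topspace X \<in> F" using up[of U "bx \<top>"] bx_regular[of \<top>] by simp
    then show ?thesis by simp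
  qed
  \<comment> \<open>As \<open>F\<close> is closed under intersection, the family \<open>?C\<close>
    is directed, and a finite subfamily supplied by compactness is bounded by one
    \<open>pc b\<close>.\<close>
  have dir: "\<exists>b\<in>?G. \<Squnion>D \<sqsubseteq> pc b" if "finite D" "D \<subseteq> ?C" for D
    using that
  proof (induction D)
    case empty then show ?case using top by (auto simp: Sup_empty)
  next
    case (insert d D)
    then obtain b where b: "b \<in> ?G" "\<Squnion>D \<sqsubseteq> pc b" by auto
    obtain c where c: "c \<in> ?G" "d = pc c" using insert by auto
    have "b \<sqinter> c \<in> ?G" using b c int by (simp add: bx_meet pc_meet_regular)
    moreover have "\<Squnion>(insert d D) \<sqsubseteq> pc (b \<sqinter> c)"
    proof -
      have D: "D \<subseteq> carrier L" using insert by auto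
      have "pc b \<sqsubseteq> pc (b \<sqinter> c)" "pc c \<sqsubseteq> pc (b \<sqinter> c)"
        using b c by (auto intro!: pc_anti meet_left meet_right)
      then have "\<Squnion>D \<sqsubseteq> pc (b \<sqinter> c)" using le_trans[OF b(2)] D by simp
      with \<open>pc c \<sqsubseteq> pc (b \<sqinter> c)\<close> show ?thesis using D c by (simp add: Sup_insert join_le)
    qed
    ultimately show ?case by blast
  qed
  have C: "?C \<subseteq> carrier L" by auto
  \<comment> \<open>This is used twice: for \<open>a = \<bottom>\<close> it shows that
    \<open>\<Squnion>?C\<close> is a point, since no member of \<open>F\<close> is empty; for
    regular \<open>a\<close> it decides whether that point lies in \<open>bx a\<close>.\<close>
  have key: "\<Squnion>?C \<squnion> a = \<top> \<longleftrightarrow> (\<exists>b\<in>?G. wi b a)" if a: "a \<in> carrier L" for a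
  proof
    assume "\<Squnion>?C \<squnion> a = \<top>"
    then obtain D where D: "finite D" "D \<subseteq> ?C" "\<Squnion>D \<squnion> a = \<top>" using compact_join[OF C a] by auto
    then obtain b where b: "b \<in> ?G" "\<Squnion>D \<sqsubseteq> pc b" using dir by blast
    moreover have "\<Squnion>D \<in> carrier L" using D C by (intro sup_closed) auto
    ultimately have "pc b \<squnion> a = \<top>" using join_top_mono[of "\<Squnion>D" a "pc b" a] D a by simp
    then show "\<exists>b\<in>?G. wi b a" using b by (auto simp: well_inside_def join_comm)
  next
    assume "\<exists>b\<in>?G. wi b a"
    then obtain b where b: "b \<in> ?G" "wi b a" by blast
    then have "pc b \<sqsubseteq> \<Squnion>?C" using C by (intro sup_upper) auto
    then show "\<Squnion>?C \<squnion> a = \<top>"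
      using join_top_mono[of "pc b" a "\<Squnion>?C" a] b a C by (simp add: well_inside_def join_comm)
  qed
  have "\<Squnion>?C \<noteq> \<top>"
  proof
    assume "\<Squnion>?C = \<top>"
    then obtain b where b: "b \<in> ?G" "wi b \<bottom>" using key[of \<bottom>] by auto
    then have "b = \<bottom>" using well_inside_le[of b \<bottom>] le_bottom by simp
    then show False using b emp by simp
  qed
  then obtain x where x: "x \<in> topspace X" "f x = \<Squnion>?C" using f_surj[of "\<Squnion>?C"] C by auto
  have eq: "(bx a \<in> F \<and> (\<exists>W\<in>F. much_below X W (bx a))) \<longleftrightarrow> x \<in> bx a"
    if a: "a \<in> carrier L" "pc (pc a) = a" for a
  proof -
    have "(\<exists>W\<in>F. much_below X W (bx a)) \<longleftrightarrow> (\<exists>b\<in>?G. wi b a)"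
    proof
      assume "\<exists>W\<in>F. much_below X W (bx a)"
      then obtain W where W: "W \<in> F" "much_below X W (bx a)" by blast
      then obtain b where "b \<in> carrier L" "pc (pc b) = b" "W = bx b"
        using FR unfolding regular_opens_eq by blast
      then show "\<exists>b\<in>?G. wi b a" using W a by (auto simp: much_below_bx)
    next
      assume "\<exists>b\<in>?G. wi b a"
      then obtain b where "b \<in> ?G" "wi b a" by blast
      then show "\<exists>W\<in>F. much_below X W (bx a)"
        using a by (intro bexI[of _ "bx b"]) (auto simp: much_below_bx)
    qed
    moreover have "bx a \<in> F" if "\<exists>b\<in>?G. wi b a"
    proof -
      from that obtain b where b: "b \<in> ?G" "wi b a" by blast
      then have "bx b \<subseteq> bx a" using a bx_mono[of b a] well_inside_le by auto
      then show ?thesis using up[of "bx b" "bx a"] b a bx_regular by auto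
    qed
    moreover have "x \<in> bx a \<longleftrightarrow> (\<exists>b\<in>?G. wi b a)"
      using key[OF a(1)] x by (simp add: bx_def join_comm)
    ultimately show ?thesis by blast
  qed
  have "U \<in> F \<and> (\<exists>W\<in>F. much_below X W U) \<longleftrightarrow> U \<in> regular_opens X \<and> x \<in> U" for U
  proof (cases "U \<in> regular_opens X")
    case True
    then obtain a where "a \<in> carrier L" "pc (pc a) = a" "U = bx a" unfolding regular_opens_eq by blast
    then show ?thesis using eq[of a] True by simp
  qed (use FR in auto)
  then show ?thesis using x(1) by (intro bexI[of _ x]) (simp_all add: RO_at_def)
qed

theorem dV_space_X: "dV_space X"
  unfolding dV_space_def
  by (intro conjI ballI allI impI t0_space_X compact_space_X order_normal_X regular_open_basis
      regular_opens_order_regular RO_at_concordant round_part_RO_at)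

end

section \<open>The locale of round filters of a dV-space\<close>

text \<open>By De Morgan this is the join of the Boolean algebra of regular open sets, that is, the
  regularization of the union.\<close>

definition ro_join :: "'a topology \<Rightarrow> 'a set \<Rightarrow> 'a set \<Rightarrow> 'a set" where
  "ro_join X U W = perp X (perp X U \<inter> perp X W)"

lemma ro_join_regular: "ro_join X U W \<in> regular_opens X"
  unfolding ro_join_def by (intro perp_regular openin_Int openin_perp)

lemma ro_join_upper:
  assumes "U \<in> regular_opens X" "W \<in> regular_opens X"
  shows "U \<subseteq> ro_join X U W" "W \<subseteq> ro_join X U W"
  unfolding ro_join_def using assms disjoint_perp[of U X] disjoint_perp[of W X]
  by (intro subset_perp; auto simp: regular_open_openin)+

lemma ro_join_least:
  assumes "U \<in> regular_opens X" "W \<subseteq> U" shows "ro_join X U W = U"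
proof -
  have "perp X U \<inter> perp X W = perp X U" using perp_anti[OF assms(2)] by blast
  then show ?thesis unfolding ro_join_def using assms by (simp add: regular_open_perp_perp)
qed

text \<open>The nontrivial half of distributivity. The part \<open>?D\<close> of the left side that
  avoids the right side misses \<open>perp X V\<close> and \<open>perp X W\<close>, so it lies in
  \<open>V \<inter> W\<close>; but it also lies in \<open>perp X (V \<inter> W)\<close>.\<close>

lemma ro_join_Int_subset:
  assumes "V \<in> regular_opens X" "W \<in> regular_opens X"
  shows "ro_join X U V \<inter> ro_join X U W \<subseteq> ro_join X U (V \<inter> W)"
proof -
  let ?J = "ro_join X U V \<inter> ro_join X U W"
  let ?D = "?J \<inter> (perp X U \<inter> perp X (V \<inter> W))"
  have J: "openin X ?J" using openin_Int[of X "ro_join X U V" "ro_join X U W"] by (simp add: ro_join_def)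
  then have D: "openin X ?D" by (rule openin_Int) (simp add: openin_Int)
  have "?D \<inter> perp X V = {}" "?D \<inter> perp X W = {}"
    using disjoint_perp[of "perp X U \<inter> perp X V" X] disjoint_perp[of "perp X U \<inter> perp X W" X]
    unfolding ro_join_def by auto
  then have "?D \<subseteq> V" "?D \<subseteq> W"
    using subset_perp[OF D, of "perp X V"] subset_perp[OF D, of "perp X W"] assms
    by (simp_all add: regular_open_perp_perp)
  then have "?D = {}" using disjoint_perp[of "V \<inter> W" X] by auto
  then show ?thesis unfolding ro_join_def[of X U "V \<inter> W"] by (rule subset_perp[OF J])
qed

text \<open>By distributivity the joins intersect within the join of \<open>U\<close> and
  \<open>\<Inter>T\<close>, which is \<open>U\<close>. The frame law uses this to replace generators
  by larger ones without leaving \<open>U\<close>.\<close>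

lemma Inter_ro_join_subset:
  assumes "finite T" "T \<subseteq> regular_opens X" "U \<in> regular_opens X" "topspace X \<inter> \<Inter>T \<subseteq> U"
  shows "topspace X \<inter> \<Inter>(ro_join X U ` T) \<subseteq> U"
proof -
  have "topspace X \<inter> \<Inter>(ro_join X U ` T) \<subseteq> ro_join X U (topspace X \<inter> \<Inter>T)"
    using assms(1,2)
  proof (induction T)
    case empty then show ?case by (simp add: ro_join_def)
  next
    case (insert V T)
    have "topspace X \<inter> \<Inter>(ro_join X U ` insert V T)
        \<subseteq> ro_join X U V \<inter> ro_join X U (topspace X \<inter> \<Inter>T)"
      using insert by auto
    also have "\<dots> \<subseteq> ro_join X U (V \<inter> (topspace X \<inter> \<Inter>T))"
      using insert by (intro ro_join_Int_subset Inter_regular) auto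
    also have "V \<inter> (topspace X \<inter> \<Inter>T) = topspace X \<inter> \<Inter>(insert V T)" by auto
    finally show ?case .
  qed
  also have "\<dots> = U" using assms by (intro ro_join_least)
  finally show ?thesis .
qed

lemma down_mono: "U \<subseteq> W \<Longrightarrow> down X U \<subseteq> down X W"
  by (auto simp: down_def)

lemma much_below_mono:
  assumes "much_below X U W" "U' \<subseteq> U" "W \<subseteq> W'" shows "much_below X U' W'"
proof -
  have "X closure_of U' \<subseteq> X closure_of U" "down X W \<subseteq> down X W'"
    using assms by (simp_all add: closure_of_mono down_mono)
  then show ?thesis using assms(1) unfolding much_below_def by simp
qed

lemma much_below_topspace: "much_below X U (topspace X)"
  using closure_of_subset_topspace[of X U] by (auto simp: much_below_def down_def spec_le_def)

section \<open>The de Vries axioms for the regular open sets\<close>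

locale dV_topology =
  fixes X :: "'a topology"
  assumes dV_X: "dV_space X"
begin

abbreviation RO :: "'a set set" where "RO \<equiv> regular_opens X"
abbreviation mb :: "'a set \<Rightarrow> 'a set \<Rightarrow> bool" (infix \<open>\<lless>\<close> 50) where "U \<lless> W \<equiv> much_below X U W"

lemma Int_le_down: "U \<in> RO \<Longrightarrow> Int_le X (down X U) = U"
  using dV_X by (auto simp: dV_space_def order_regular_opens_def)

text \<open>Open sets are upward closed, so an open subset of \<open>down X V\<close> lies in
  \<open>Int_le X (down X V)\<close>, which is \<open>V\<close> by order-regularity.\<close>

lemma much_below_subset:
  assumes "U \<in> RO" "V \<in> RO" "U \<lless> V" shows "U \<subseteq> V"
proof -
  have "U \<subseteq> down X V"
    using assms closure_of_subset[of U X] regular_open_subset by (auto simp: much_below_def)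
  then have "U \<subseteq> Int_le X (down X V)"
    using assms regular_open_openin[of U X] regular_open_subset[of U X] by (auto simp: Int_le_def spec_le_def)
  then show ?thesis using assms Int_le_down by simp
qed

lemma much_below_perp:
  assumes "U \<in> RO" "V \<in> RO" "U \<lless> V" shows "perp X V \<lless> perp X U"
  unfolding much_below_def
proof
  fix x assume "x \<in> X closure_of perp X V"
  then have x: "x \<in> topspace X" "x \<notin> V"
    using assms by (simp_all add: closure_of_eq_perp perp_subset_topspace regular_open_perp_perp)
  \<comment> \<open>Since \<open>V\<close> equals \<open>Int_le X (down X V)\<close>, a point
    outside \<open>V\<close> has a point above it outside \<open>down X V\<close>, hence outside the
    closure of \<open>U\<close>.\<close>
  then obtain y where y: "spec_le X x y" "y \<notin> down X V"
    using Int_le_down[of V] assms by (auto simp: Int_le_def)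
  then have "y \<in> perp X U"
    using assms closure_of_eq_perp[of U X] regular_open_subset[of U X]
    by (auto simp: much_below_def spec_le_def)
  then show "x \<in> down X (perp X U)" using x y by (auto simp: down_def)
qed

text \<open>\<open>down\<close> need not preserve intersections, but the closure of
  \<open>perp X (V \<inter> W)\<close> is the union of the closures of \<open>perp X V\<close> and
  \<open>perp X W\<close>. Contraposing twice moves the claim there and back.\<close>

lemma much_below_Int:
  assumes "U \<in> RO" "V \<in> RO" "W \<in> RO" "U \<lless> V" "U \<lless> W" shows "U \<lless> V \<inter> W"
proof -
  let ?J = "perp X (V \<inter> W)"
  have VW: "V \<inter> W \<in> RO" using assms by (simp add: Int_regular)
  have "X closure_of ?J = X closure_of perp X V \<union> X closure_of perp X W"
    using assms VW by (auto simp: closure_of_eq_perp perp_subset_topspace regular_open_perp_perp)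
  then have J: "?J \<lless> perp X U"
    using much_below_perp[of U V] much_below_perp[of U W] assms by (simp add: much_below_def)
  have "perp X (perp X U) \<lless> perp X ?J"
    by (rule much_below_perp[OF _ _ J]) (use assms VW in \<open>simp_all add: perp_regular regular_open_openin\<close>)
  moreover have "perp X ?J = V \<inter> W" "perp X (perp X U) = U"
    using assms VW regular_open_perp_perp by blast+
  ultimately show ?thesis by simp
qed

text \<open>For the closure of \<open>U\<close> and the complement of \<open>V\<close>, the
  disjointness required by order-normality says exactly \<open>U \<lless> V\<close>.\<close>

lemma much_below_interpolate:
  assumes "U \<in> RO" "V \<in> RO" "U \<lless> V"
  obtains W where "W \<in> RO" "U \<lless> W" "W \<lless> V"
proof -
  let ?A = "X closure_of U" and ?B = "topspace X - V"
  have IB: "Int_le X ?B = topspace X - down X V"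
    unfolding Int_le_eq using regular_open_subset[OF assms(2)] by (simp add: double_diff)
  have "regular_closed X ?B"
    unfolding regular_closed_iff using assms regular_open_subset[OF assms(2)] by (simp add: double_diff)
  moreover have "?A \<inter> Int_le X ?B = {}" using assms(3) unfolding IB much_below_def by blast
  moreover have "order_normal X" using dV_X by (simp add: dV_space_def)
  ultimately have "\<exists>P Q. openin X P \<and> openin X Q \<and> P \<inter> Q = {} \<and> ?A \<subseteq> down X P \<and> Int_le X ?B \<subseteq> Q"
    using closedin_closure_of[of X U] by (simp add: order_normal_def)
  then obtain P Q where PQ: "openin X P" "openin X Q" "P \<inter> Q = {}" "?A \<subseteq> down X P" "Int_le X ?B \<subseteq> Q"
    by blast
  \<comment> \<open>Regularizing \<open>P\<close> does no harm: \<open>Q\<close> misses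
    \<open>P\<close>, hence lies in \<open>perp X P\<close>, which is the complement of the closure
    of \<open>?W\<close>.\<close>
  let ?W = "perp X (perp X P)"
  have W: "?W \<in> RO" by (simp add: perp_regular)
  have PW: "P \<subseteq> ?W" using PQ by (simp add: subset_perp_perp)
  have "U \<lless> ?W" using PQ(4) down_mono[OF PW] by (auto simp: much_below_def)
  moreover have "?W \<lless> V"
  proof -
    have "X closure_of ?W = topspace X - perp X P"
      using W PQ(1) by (simp add: closure_of_eq_perp perp_subset_topspace
          regular_open_perp_perp perp_regular)
    moreover have "Q \<subseteq> perp X P" using PQ by (intro subset_perp) auto
    ultimately show ?thesis using PQ(5) unfolding IB much_below_def by auto
  qed
  ultimately show ?thesis using that W by blast
qed

lemma much_below_ro_join:
  assumes "U \<in> RO" "V \<in> RO" "W \<in> RO" "V \<lless> U" "W \<lless> U" shows "ro_join X V W \<lless> U"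
proof -
  have r: "perp X U \<in> RO" "perp X V \<in> RO" "perp X W \<in> RO"
    using assms by (simp_all add: perp_regular regular_open_openin)
  then have "perp X U \<lless> perp X V \<inter> perp X W"
    using assms by (intro much_below_Int much_below_perp) auto
  then have "ro_join X V W \<lless> perp X (perp X U)"
    unfolding ro_join_def using r by (intro much_below_perp Int_regular) auto
  then show ?thesis using assms by (simp add: regular_open_perp_perp)
qed

text \<open>In contrast to \<^const>\<open>RO_filter\<close>, the improper filter is included; it becomes the top element.\<close>

definition round_filter :: "'a set set \<Rightarrow> bool" where
  "round_filter F \<longleftrightarrow> F \<subseteq> RO \<and> topspace X \<in> F \<and> (\<forall>U\<in>F. \<forall>W\<in>F. U \<inter> W \<in> F) \<and>
    (\<forall>U\<in>F. \<forall>W\<in>RO. U \<subseteq> W \<longrightarrow> W \<in> F) \<and> (\<forall>U\<in>F. \<exists>W\<in>F. W \<lless> U)"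

lemma round_filterI:
  assumes "F \<subseteq> RO" "topspace X \<in> F" "\<And>U W. \<lbrakk>U \<in> F; W \<in> F\<rbrakk> \<Longrightarrow> U \<inter> W \<in> F"
    "\<And>U W. \<lbrakk>U \<in> F; W \<in> RO; U \<subseteq> W\<rbrakk> \<Longrightarrow> W \<in> F" "\<And>U. U \<in> F \<Longrightarrow> \<exists>W\<in>F. W \<lless> U"
  shows "round_filter F"
  unfolding round_filter_def using assms by (intro conjI ballI impI)

context
  fixes F assumes F: "round_filter F"
begin

lemma round_filter_subset: "F \<subseteq> RO" and topspace_mem_round_filter: "topspace X \<in> F"
  and Int_mem_round_filter: "\<lbrakk>U \<in> F; W \<in> F\<rbrakk> \<Longrightarrow> U \<inter> W \<in> F"
  and round_filter_upward: "\<lbrakk>U \<in> F; W \<in> RO; U \<subseteq> W\<rbrakk> \<Longrightarrow> W \<in> F"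
  and round_filter_much_below: "U \<in> F \<Longrightarrow> \<exists>W\<in>F. W \<lless> U"
  using F unfolding round_filter_def by simp_all

lemma round_filter_regular: "U \<in> F \<Longrightarrow> U \<in> RO" using round_filter_subset by auto

lemma Inter_mem_round_filter: "\<lbrakk>finite T; T \<subseteq> F\<rbrakk> \<Longrightarrow> topspace X \<inter> \<Inter>T \<in> F"
proof (induction T rule: finite_induct)
  case (insert U T)
  then have "U \<inter> (topspace X \<inter> \<Inter>T) \<in> F" by (rule_tac Int_mem_round_filter) auto
  moreover have "U \<inter> (topspace X \<inter> \<Inter>T) = topspace X \<inter> \<Inter>(insert U T)" by auto
  ultimately show ?case by simp
qed (simp add: topspace_mem_round_filter)

lemma round_filter_eq_RO_iff: "F = RO \<longleftrightarrow> {} \<in> F"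
  using round_filter_upward[of "{}"] round_filter_subset empty_regular[of X] by auto

end

section \<open>Constructions of round filters\<close>

lemma round_filter_RO: "round_filter RO"
proof (rule round_filterI)
  fix U assume "U \<in> RO"
  have "{} \<lless> U" by (simp add: much_below_def)
  then show "\<exists>W\<in>RO. W \<lless> U" using empty_regular by blast
qed (auto simp: Int_regular)

lemma round_filter_topspace: "round_filter {topspace X}"
  by (rule round_filterI) (auto simp: much_below_topspace dest: regular_open_subset)

lemma round_filter_Int:
  assumes "round_filter F" "round_filter G" shows "round_filter (F \<inter> G)"
proof (rule round_filterI)
  fix U assume U: "U \<in> F \<inter> G"
  obtain V W where VW: "V \<in> F" "V \<lless> U" "W \<in> G" "W \<lless> U"
    using U round_filter_much_below[OF assms(1)] round_filter_much_below[OF assms(2)] by blast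
  have r: "U \<in> RO" "V \<in> RO" "W \<in> RO"
    using U VW round_filter_regular[OF assms(1)] round_filter_regular[OF assms(2)] by auto
  \<comment> \<open>The join of the two witnesses lies in both filters by upward closure and is
    still much below \<open>U\<close>.\<close>
  have "ro_join X V W \<in> F" "ro_join X V W \<in> G"
    using round_filter_upward[OF assms(1), of V] round_filter_upward[OF assms(2), of W] VW r ro_join_upper[of V X W] ro_join_regular[of X V W] by auto
  moreover have "ro_join X V W \<lless> U" using VW r by (intro much_below_ro_join)
  ultimately show "\<exists>W\<in>F \<inter> G. W \<lless> U" by blast
next
  show "F \<inter> G \<subseteq> RO" using round_filter_subset[OF assms(1)] by auto
  show "topspace X \<in> F \<inter> G" using assms by (simp add: topspace_mem_round_filter)
  show "U \<inter> W \<in> F \<inter> G" if "U \<in> F \<inter> G" "W \<in> F \<inter> G" for U W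
    using that Int_mem_round_filter[OF assms(1)] Int_mem_round_filter[OF assms(2)] by simp
  show "W \<in> F \<inter> G" if "U \<in> F \<inter> G" "W \<in> RO" "U \<subseteq> W" for U W
    using that round_filter_upward[OF assms(1)] round_filter_upward[OF assms(2)] by blast
qed

text \<open>Roundness is interpolation, closure under intersection is \<open>much_below_Int\<close>.
  These filters witness regularity of the locale and give the boxes that represent regular open
  sets.\<close>

lemma round_filter_above:
  assumes "U \<in> RO" shows "round_filter {V \<in> RO. U \<lless> V}"
proof (rule round_filterI)
  fix V assume "V \<in> {V \<in> RO. U \<lless> V}"
  then show "\<exists>W\<in>{V \<in> RO. U \<lless> V}. W \<lless> V" using much_below_interpolate[of U V] assms by auto
next
  show "W \<in> {V \<in> RO. U \<lless> V}" if "V \<in> {V \<in> RO. U \<lless> V}" "W \<in> RO" "V \<subseteq> W" for V W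
    using that much_below_mono[of X U V U W] by simp
qed (use assms in \<open>auto simp: much_below_topspace Int_regular much_below_Int\<close>)

text \<open>The intersection with \<^term>\<open>topspace X\<close> matters for \<open>T = {}\<close>, where \<open>\<Inter>T\<close> is \<open>UNIV\<close>.\<close>

definition gen :: "'a set set set \<Rightarrow> 'a set set" where
  "gen \<S> = {U \<in> RO. \<exists>T. finite T \<and> T \<subseteq> \<Union>\<S> \<and> topspace X \<inter> \<Inter>T \<subseteq> U}"

lemma genI: "\<lbrakk>U \<in> RO; finite T; T \<subseteq> \<Union>\<S>; topspace X \<inter> \<Inter>T \<subseteq> U\<rbrakk> \<Longrightarrow> U \<in> gen \<S>"
  unfolding gen_def by blast

lemma genE:
  assumes "U \<in> gen \<S>"
  obtains T where "U \<in> RO" "finite T" "T \<subseteq> \<Union>\<S>" "topspace X \<inter> \<Inter>T \<subseteq> U"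
  using assms by (auto simp: gen_def)

lemma gen_upper: "\<lbrakk>F \<in> \<S>; round_filter F\<rbrakk> \<Longrightarrow> F \<subseteq> gen \<S>"
proof
  fix U assume "F \<in> \<S>" "round_filter F" "U \<in> F"
  then show "U \<in> gen \<S>" using round_filter_regular[of F U] by (intro genI[of U "{U}"]) auto
qed

lemma gen_least:
  assumes "round_filter G" "\<And>F. F \<in> \<S> \<Longrightarrow> F \<subseteq> G" shows "gen \<S> \<subseteq> G"
proof
  fix U assume "U \<in> gen \<S>"
  then obtain T where T: "U \<in> RO" "finite T" "T \<subseteq> \<Union>\<S>" "topspace X \<inter> \<Inter>T \<subseteq> U" by (rule genE)
  then have "T \<subseteq> G" using assms(2) by blast
  then have "topspace X \<inter> \<Inter>T \<in> G" using Inter_mem_round_filter[OF assms(1)] T by simp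
  then show "U \<in> G" using round_filter_upward[OF assms(1)] T by simp
qed

text \<open>Each member of \<open>T\<close> has a set much below it in its own filter, and
  \<open>much_below_Int\<close> combines finitely many of these.\<close>

lemma round_filters_Inter_round:
  assumes \<S>: "\<And>F. F \<in> \<S> \<Longrightarrow> round_filter F" and "finite T" "T \<subseteq> \<Union>\<S>"
  shows "\<exists>T'. finite T' \<and> T' \<subseteq> \<Union>\<S> \<and> topspace X \<inter> \<Inter>T' \<lless> topspace X \<inter> \<Inter>T"
  using assms(2,3)
proof (induction T)
  case empty
  have "topspace X \<inter> \<Inter>{} \<lless> topspace X \<inter> \<Inter>{}" by (simp add: much_below_topspace)
  then show ?case by blast
next
  case (insert U T)
  then obtain T' where T': "finite T'" "T' \<subseteq> \<Union>\<S>" "topspace X \<inter> \<Inter>T' \<lless> topspace X \<inter> \<Inter>T" by auto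
  obtain F where F: "F \<in> \<S>" "U \<in> F" using insert.prems by auto
  then obtain W where W: "W \<in> F" "W \<lless> U" using round_filter_much_below[OF \<S>, of F U] by auto
  have S: "\<Union>\<S> \<subseteq> RO" using round_filter_subset[OF \<S>] by (rule Union_least)
  let ?Y = "topspace X \<inter> \<Inter>(insert W T')" and ?Z = "topspace X \<inter> \<Inter>T"
  have sub: "insert W T' \<subseteq> \<Union>\<S>" using T'(2) W(1) F(1) by auto
  have "?Y \<in> RO" by (rule Inter_regular) (use T'(1) sub S in auto)
  moreover have "?Z \<in> RO" by (rule Inter_regular) (use insert S in auto)
  moreover have "U \<in> RO" using S F by auto
  moreover have "?Y \<lless> U" by (rule much_below_mono[OF W(2)]) auto
  moreover have "?Y \<lless> ?Z" by (rule much_below_mono[OF T'(3)]) auto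
  ultimately have "?Y \<lless> U \<inter> ?Z" by (rule_tac much_below_Int)
  moreover have "U \<inter> ?Z = topspace X \<inter> \<Inter>(insert U T)" by auto
  ultimately have "?Y \<lless> topspace X \<inter> \<Inter>(insert U T)" by metis
  then show ?case using T'(1) sub by blast
qed

lemma round_filter_gen:
  assumes \<S>: "\<And>F. F \<in> \<S> \<Longrightarrow> round_filter F" shows "round_filter (gen \<S>)"
proof (rule round_filterI)
  show "gen \<S> \<subseteq> RO" by (auto simp: gen_def)
  show "topspace X \<in> gen \<S>" by (rule genI[of _ "{}"]) auto
  show "W \<in> gen \<S>" if "U \<in> gen \<S>" "W \<in> RO" "U \<subseteq> W" for U W
  proof -
    from that(1) obtain T where "finite T" "T \<subseteq> \<Union>\<S>" "topspace X \<inter> \<Inter>T \<subseteq> U" by (rule genE)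
    then show ?thesis using that genI[of W T \<S>] order_trans by metis
  qed
  show "U \<inter> W \<in> gen \<S>" if UW: "U \<in> gen \<S>" "W \<in> gen \<S>" for U W
  proof -
    from UW(1) obtain T where T: "U \<in> RO" "finite T" "T \<subseteq> \<Union>\<S>" "topspace X \<inter> \<Inter>T \<subseteq> U"
      by (rule genE)
    from UW(2) obtain T' where T': "W \<in> RO" "finite T'" "T' \<subseteq> \<Union>\<S>" "topspace X \<inter> \<Inter>T' \<subseteq> W"
      by (rule genE)
    have "topspace X \<inter> \<Inter>(T \<union> T') \<subseteq> U \<inter> W" using T(4) T'(4) by blast
    then show ?thesis using T(1-3) T'(1-3) by (intro genI[of _ "T \<union> T'"]) (simp_all add: Int_regular del: Int_subset_iff)
  qed
  have S: "\<Union>\<S> \<subseteq> RO" using round_filter_subset[OF \<S>] by (rule Union_least)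
  fix U assume "U \<in> gen \<S>"
  then obtain T where T: "finite T" "T \<subseteq> \<Union>\<S>" "topspace X \<inter> \<Inter>T \<subseteq> U" by (rule genE)
  from round_filters_Inter_round[OF \<S> T(1,2)]
  obtain T' where T': "finite T'" "T' \<subseteq> \<Union>\<S>" "topspace X \<inter> \<Inter>T' \<lless> topspace X \<inter> \<Inter>T"
    by blast
  have "topspace X \<inter> \<Inter>T' \<in> RO" by (rule Inter_regular) (use T' S in auto)
  then have "topspace X \<inter> \<Inter>T' \<in> gen \<S>" using T' by (intro genI[of _ T']) simp_all
  moreover have "topspace X \<inter> \<Inter>T' \<lless> U" using much_below_mono[OF T'(3) _ T(3)] by simp
  ultimately show "\<exists>W\<in>gen \<S>. W \<lless> U" by blast
qed

text \<open>A finite set of generators is split according to the filter containing them; each part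
  collapses to its intersection.\<close>

lemma gen_pair:
  assumes "round_filter F" "round_filter G" "U \<in> RO"
  shows "U \<in> gen {F, G} \<longleftrightarrow> (\<exists>A\<in>F. \<exists>B\<in>G. A \<inter> B \<subseteq> U)"
proof
  assume "U \<in> gen {F, G}"
  then obtain T where T: "finite T" "T \<subseteq> F \<union> G" "topspace X \<inter> \<Inter>T \<subseteq> U" by (auto elim: genE)
  let ?A = "topspace X \<inter> \<Inter>(T \<inter> F)" and ?B = "topspace X \<inter> \<Inter>(T \<inter> G)"
  have "?A \<in> F" "?B \<in> G" using T(1) assms(1,2) by (auto intro!: Inter_mem_round_filter)
  moreover have "?A \<inter> ?B \<subseteq> U"
  proof -
    have "\<Inter>T = \<Inter>(T \<inter> F) \<inter> \<Inter>(T \<inter> G)"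
      using T(2) Inter_Un_distrib[of "T \<inter> F" "T \<inter> G"] by (simp add: Int_Un_distrib[symmetric] Int_absorb2)
    then show ?thesis using T(3) by auto
  qed
  ultimately show "\<exists>A\<in>F. \<exists>B\<in>G. A \<inter> B \<subseteq> U" by blast
next
  assume "\<exists>A\<in>F. \<exists>B\<in>G. A \<inter> B \<subseteq> U"
  then obtain A B where "A \<in> F" "B \<in> G" "A \<inter> B \<subseteq> U" by blast
  then show "U \<in> gen {F, G}" using assms(3) by (intro genI[of U "{A, B}"]) auto
qed

section \<open>The compact regular locale of round filters\<close>

definition filter_frame :: "'a set set gorder" where
  "filter_frame = \<lparr>carrier = {F. round_filter F}, eq = (=), le = (\<subseteq>)\<rparr>"

lemma filter_frame_simps [simp]:
  "F \<in> carrier filter_frame \<longleftrightarrow> round_filter F"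
  "F .=\<^bsub>filter_frame\<^esub> G \<longleftrightarrow> F = G"
  "F \<sqsubseteq>\<^bsub>filter_frame\<^esub> G \<longleftrightarrow> F \<subseteq> G"
  by (simp_all add: filter_frame_def)

lemma complete_lattice_filter_frame: "complete_lattice filter_frame"
proof -
  interpret partial_order filter_frame
    by unfold_locales (auto simp: filter_frame_def)
  have lub: "least filter_frame (gen A) (Upper filter_frame A)" if "A \<subseteq> carrier filter_frame" for A
  proof (rule least_UpperI)
    have A: "round_filter F" if "F \<in> A" for F using that \<open>A \<subseteq> _\<close> by auto
    show "F \<sqsubseteq>\<^bsub>filter_frame\<^esub> gen A" if "F \<in> A" for F
      using that A gen_upper by simp
    show "gen A \<sqsubseteq>\<^bsub>filter_frame\<^esub> G" if G: "G \<in> Upper filter_frame A" for G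
    proof -
      have "round_filter G" "\<And>F. F \<in> A \<Longrightarrow> F \<subseteq> G" using G A by (auto simp: Upper_def)
      then show ?thesis by (simp add: gen_least)
    qed
    show "gen A \<in> carrier filter_frame" using A by (simp add: round_filter_gen)
  qed (use that in simp)
  show ?thesis
  proof (rule complete_latticeI)
    fix A assume A: "A \<subseteq> carrier filter_frame"
    show "\<exists>s. least filter_frame s (Upper filter_frame A)" using lub[OF A] by blast
    \<comment> \<open>An infinite intersection of round filters may fail to be round, so the infimum
      is generated by the lower bounds instead.\<close>
    let ?B = "Lower filter_frame A"
    have B: "?B \<subseteq> carrier filter_frame" by (simp add: Lower_def)
    have rB: "round_filter F" if "F \<in> ?B" for F using that by (simp add: Lower_def)
    have "greatest filter_frame (gen ?B) ?B"
    proof (rule greatest_LowerI)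
      show "gen ?B \<sqsubseteq>\<^bsub>filter_frame\<^esub> F" if F: "F \<in> A" for F
      proof -
        have rF: "round_filter F" using F A by auto
        have "G \<subseteq> F" if "G \<in> ?B" for G using that F rF by (auto simp: Lower_def)
        then show ?thesis using gen_least[OF rF] by simp
      qed
      show "G \<sqsubseteq>\<^bsub>filter_frame\<^esub> gen ?B" if "G \<in> ?B" for G
        using that rB gen_upper[of G ?B] by simp
      show "gen ?B \<in> carrier filter_frame" using rB by (simp add: round_filter_gen)
    qed (rule A)
    then show "\<exists>i. greatest filter_frame i ?B" by blast
  qed
qed

interpretation FL: complete_lattice filter_frame by (rule complete_lattice_filter_frame)

lemma Sup_filter_frame:
  assumes "\<And>F. F \<in> A \<Longrightarrow> round_filter F"
  shows "\<Squnion>\<^bsub>filter_frame\<^esub> A = gen A"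
proof (rule FL.le_antisym)
  have A: "A \<subseteq> carrier filter_frame" using assms by auto
  show "\<Squnion>\<^bsub>filter_frame\<^esub> A \<sqsubseteq>\<^bsub>filter_frame\<^esub> gen A"
    using A assms by (intro FL.weak.sup_least) (simp_all add: gen_upper round_filter_gen)
  have c: "\<Squnion>\<^bsub>filter_frame\<^esub> A \<in> carrier filter_frame" using A by (rule FL.weak.sup_closed)
  have "gen A \<subseteq> \<Squnion>\<^bsub>filter_frame\<^esub> A"
  proof (rule gen_least)
    show "F \<subseteq> \<Squnion>\<^bsub>filter_frame\<^esub> A" if "F \<in> A" for F
      using FL.weak.sup_upper[OF A that] by simp
  qed (use c in simp)
  then show "gen A \<sqsubseteq>\<^bsub>filter_frame\<^esub> \<Squnion>\<^bsub>filter_frame\<^esub> A" by simp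
  show "\<Squnion>\<^bsub>filter_frame\<^esub> A \<in> carrier filter_frame" by (rule c)
  show "gen A \<in> carrier filter_frame" using assms by (simp add: round_filter_gen)
qed

lemma join_filter_frame:
  "\<lbrakk>round_filter F; round_filter G\<rbrakk> \<Longrightarrow> F \<squnion>\<^bsub>filter_frame\<^esub> G = gen {F, G}"
  unfolding join_def by (rule Sup_filter_frame) auto

lemma meet_filter_frame:
  assumes "round_filter F" "round_filter G"
  shows "F \<sqinter>\<^bsub>filter_frame\<^esub> G = F \<inter> G"
proof -
  have "F \<sqinter>\<^bsub>filter_frame\<^esub> G \<subseteq> F" "F \<sqinter>\<^bsub>filter_frame\<^esub> G \<subseteq> G"
    using FL.weak.meet_left[of F G] FL.weak.meet_right[of F G] assms by simp_all
  moreover have "F \<inter> G \<subseteq> F \<sqinter>\<^bsub>filter_frame\<^esub> G"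
    using FL.weak.meet_le[of "F \<inter> G" F G] assms by (simp add: round_filter_Int)
  ultimately show ?thesis by blast
qed

lemma top_filter_frame: "\<top>\<^bsub>filter_frame\<^esub> = RO"
proof -
  have "\<top>\<^bsub>filter_frame\<^esub> \<subseteq> RO" using FL.weak.top_closed round_filter_subset by simp
  moreover have "RO \<subseteq> \<top>\<^bsub>filter_frame\<^esub>" using FL.weak.top_higher[of RO] round_filter_RO by simp
  ultimately show ?thesis by blast
qed

lemma bottom_filter_frame: "\<bottom>\<^bsub>filter_frame\<^esub> = {topspace X}"
proof -
  have "\<bottom>\<^bsub>filter_frame\<^esub> \<subseteq> {topspace X}"
    using FL.weak.bottom_lower[of "{topspace X}"] round_filter_topspace by simp
  moreover have "topspace X \<in> \<bottom>\<^bsub>filter_frame\<^esub>" using FL.weak.bottom_closed topspace_mem_round_filter by simp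
  ultimately show ?thesis by blast
qed

text \<open>The top is the improper filter, so a join is the top as soon as it contains the empty
  set.\<close>

lemma join_eq_top_iff:
  assumes "round_filter F" "round_filter G"
  shows "F \<squnion>\<^bsub>filter_frame\<^esub> G = \<top>\<^bsub>filter_frame\<^esub> \<longleftrightarrow> (\<exists>A\<in>F. \<exists>B\<in>G. A \<inter> B = {})"
proof -
  have "round_filter (gen {F, G})" using assms by (intro round_filter_gen) auto
  then have "gen {F, G} = RO \<longleftrightarrow> {} \<in> gen {F, G}" by (rule round_filter_eq_RO_iff)
  then show ?thesis using assms gen_pair[of F G "{}"] by (simp add: join_filter_frame top_filter_frame)
qed

lemma frame_filter_frame: "frame filter_frame"
proof unfold_locales
  fix F \<S> assume F: "F \<in> carrier filter_frame" and S: "\<S> \<subseteq> carrier filter_frame"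
  let ?M = "{F \<sqinter>\<^bsub>filter_frame\<^esub> G | G. G \<in> \<S>}"
  have rF: "round_filter F" and rS: "\<And>G. G \<in> \<S> \<Longrightarrow> round_filter G" using F S by auto
  have "F \<sqinter>\<^bsub>filter_frame\<^esub> G = F \<inter> G" if "G \<in> \<S>" for G
    using rF rS[OF that] by (rule meet_filter_frame)
  then have M: "?M = (\<inter>) F ` \<S>" unfolding Setcompr_eq_image by (rule image_cong[OF refl])
  have rM: "\<And>G. G \<in> (\<inter>) F ` \<S> \<Longrightarrow> round_filter G" using rF rS by (auto simp: round_filter_Int)
  have "F \<inter> gen \<S> \<subseteq> gen ((\<inter>) F ` \<S>)"
  proof
    fix U assume U: "U \<in> F \<inter> gen \<S>"
    then have "U \<in> gen \<S>" by simp
    then obtain T where T: "U \<in> RO" "finite T" "T \<subseteq> \<Union>\<S>" "topspace X \<inter> \<Inter>T \<subseteq> U" by (rule genE)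
    have TR: "T \<subseteq> RO" using T(3) rS round_filter_regular by blast
    \<comment> \<open>A generator \<open>V\<close> from \<open>G \<in> \<S>\<close> need not lie in
      \<open>F\<close>, but its join with \<open>U \<in> F\<close> lies in both \<open>F\<close> and
      \<open>G\<close>.\<close>
    show "U \<in> gen ((\<inter>) F ` \<S>)"
    proof (rule genI)
      show "topspace X \<inter> \<Inter>(ro_join X U ` T) \<subseteq> U" using Inter_ro_join_subset[of T X U] T TR by simp
      show "ro_join X U ` T \<subseteq> \<Union>((\<inter>) F ` \<S>)"
      proof
        fix J assume "J \<in> ro_join X U ` T"
        then obtain V where V: "V \<in> T" "J = ro_join X U V" by auto
        then obtain G where G: "G \<in> \<S>" "V \<in> G" using T by auto
        have "J \<in> RO" "U \<subseteq> J" "V \<subseteq> J" using ro_join_upper[of U X V] T(1) V TR ro_join_regular by auto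
        then have "J \<in> F" "J \<in> G" using round_filter_upward[OF rF, of U J] round_filter_upward[OF rS[OF G(1)], of V J] U G by auto
        then show "J \<in> \<Union>((\<inter>) F ` \<S>)" using G by auto
      qed
    qed (use T in auto)
  qed
  moreover have "gen ((\<inter>) F ` \<S>) \<subseteq> F" using rF by (intro gen_least) auto
  moreover have "gen ((\<inter>) F ` \<S>) \<subseteq> gen \<S>"
    using rS by (intro gen_least round_filter_gen) (auto dest: gen_upper)
  ultimately have "F \<inter> gen \<S> = gen ((\<inter>) F ` \<S>)" by blast
  then show "F \<sqinter>\<^bsub>filter_frame\<^esub> \<Squnion>\<^bsub>filter_frame\<^esub>\<S> = \<Squnion>\<^bsub>filter_frame\<^esub>?M"
    unfolding M using rF rS rM by (simp add: meet_filter_frame Sup_filter_frame round_filter_gen)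
qed

interpretation FL: frame filter_frame by (rule frame_filter_frame)

text \<open>The pseudo-complement is not computed; the filter \<open>?H\<close> above
  \<open>perp X W\<close> lies below it and suffices. A set in both filters contains
  \<open>W\<close> and \<open>perp X W\<close>, so it is dense and, being regular, the whole space.
  Roundness of \<open>F\<close> gives \<open>W' \<lless> W\<close>, and
  \<open>perp X W' \<in> ?H\<close> is disjoint from \<open>W' \<in> F\<close>.\<close>

lemma well_inside_above:
  assumes "round_filter F" "U \<in> F" "W \<in> F" "W \<lless> U"
  shows "well_inside filter_frame {V \<in> RO. W \<lless> V} F"
proof -
  let ?G = "{V \<in> RO. W \<lless> V}" and ?H = "{V \<in> RO. perp X W \<lless> V}"
  have W: "W \<in> RO" using assms round_filter_regular by blast
  then have pW: "perp X W \<in> RO" by (simp add: perp_regular regular_open_openin)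
  have r: "round_filter ?G" "round_filter ?H" using round_filter_above W pW by auto
  have "V = topspace X" if "V \<in> ?G \<inter> ?H" for V
  proof -
    have "W \<subseteq> V" "perp X W \<subseteq> V" using that much_below_subset W pW by auto
    then have "perp X V \<subseteq> perp X W" "V \<inter> perp X V = {}"
      by (simp_all add: perp_anti disjoint_perp)
    then have "perp X V = {}" using \<open>perp X W \<subseteq> V\<close> by blast
    then show ?thesis using that regular_open_perp_perp[of V X] by simp
  qed
  moreover have "topspace X \<in> ?G \<inter> ?H" by (simp add: much_below_topspace)
  ultimately have "?G \<inter> ?H = {topspace X}" by blast
  then have "?H \<sqsubseteq>\<^bsub>filter_frame\<^esub> pseudo_compl filter_frame ?G"
    using r by (intro FL.pc_greatest) (simp_all add: meet_filter_frame bottom_filter_frame)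
  moreover have "F \<squnion>\<^bsub>filter_frame\<^esub> ?H = \<top>\<^bsub>filter_frame\<^esub>"
  proof -
    obtain W' where W': "W' \<in> F" "W' \<lless> W" using round_filter_much_below[OF assms(1,3)] by blast
    then have rW': "W' \<in> RO" using round_filter_regular[OF assms(1)] by blast
    then have "perp X W' \<in> ?H"
      using W' W much_below_perp[of W' W] by (simp add: perp_regular regular_open_openin)
    then show ?thesis using W' assms(1) r(2) disjoint_perp[of W' X] by (auto simp: join_eq_top_iff)
  qed
  ultimately show ?thesis
    unfolding well_inside_def
    using assms(1) r FL.join_top_mono[of F ?H F "pseudo_compl filter_frame ?G"] FL.pc_closed[of ?G]
    by simp
qed

lemma compact_regular_filter_frame: "compact_regular_locale filter_frame"
proof unfold_locales
  fix \<S> assume S: "\<S> \<subseteq> carrier filter_frame" and top: "\<Squnion>\<^bsub>filter_frame\<^esub>\<S> = \<top>\<^bsub>filter_frame\<^esub>"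
  have rS: "\<And>G. G \<in> \<S> \<Longrightarrow> round_filter G" using S by auto
  \<comment> \<open>Only the empty set has to be generated; this takes finitely many sets, hence
    finitely many of the filters.\<close>
  then have "{} \<in> gen \<S>" using top by (simp add: Sup_filter_frame top_filter_frame)
  then obtain T where T: "finite T" "T \<subseteq> \<Union>\<S>" "topspace X \<inter> \<Inter>T \<subseteq> {}" by (rule genE)
  obtain \<S>' where S': "finite \<S>'" "\<S>' \<subseteq> \<S>" "T \<subseteq> \<Union>\<S>'" using finite_subset_Union[OF T(1,2)] by blast
  have rS': "\<And>G. G \<in> \<S>' \<Longrightarrow> round_filter G" using rS S' by blast
  have "{} \<in> gen \<S>'" using T S' by (intro genI) auto
  then have "gen \<S>' = RO" using round_filter_eq_RO_iff round_filter_gen rS' by blast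
  then have "\<Squnion>\<^bsub>filter_frame\<^esub>\<S>' = \<top>\<^bsub>filter_frame\<^esub>" using rS' by (simp add: Sup_filter_frame top_filter_frame)
  then show "\<exists>B'. finite B' \<and> B' \<subseteq> \<S> \<and> \<Squnion>\<^bsub>filter_frame\<^esub>B' = \<top>\<^bsub>filter_frame\<^esub>" using S' by blast
next
  fix F assume "F \<in> carrier filter_frame"
  then have F: "round_filter F" by simp
  let ?B = "{G \<in> carrier filter_frame. well_inside filter_frame G F}"
  have rB: "\<And>G. G \<in> ?B \<Longrightarrow> round_filter G" by simp
  have "F \<subseteq> gen ?B"
  proof
    fix U assume U: "U \<in> F"
    \<comment> \<open>Roundness places \<open>U\<close> in the filter above some
      \<open>W \<in> F\<close>, and that filter is well inside \<open>F\<close>.\<close>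
    then obtain W where W: "W \<in> F" "W \<lless> U" using round_filter_much_below[OF F] by blast
    let ?G = "{V \<in> RO. W \<lless> V}"
    have "W \<in> RO" "U \<in> RO" using W U round_filter_regular[OF F] by auto
    then have "?G \<in> ?B" "U \<in> ?G" "round_filter ?G"
      using well_inside_above[OF F U W] round_filter_above[of W] W by auto
    then show "U \<in> gen ?B" using gen_upper[of ?G ?B] by auto
  qed
  moreover have "gen ?B \<subseteq> F"
  proof (rule gen_least[OF F])
    show "G \<subseteq> F" if "G \<in> ?B" for G using that F FL.well_inside_le[of G F] by auto
  qed
  ultimately have "F = gen ?B" by (rule subset_antisym)
  also have "gen ?B = \<Squnion>\<^bsub>filter_frame\<^esub>?B" by (rule Sup_filter_frame[OF rB, symmetric])
  finally show "F = \<Squnion>\<^bsub>filter_frame\<^esub>?B" .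
qed

section \<open>Points as proper round filters\<close>

lemma RO_at_round:
  assumes "x \<in> topspace X" shows "round_filter (RO_at X x)" "{} \<notin> RO_at X x"
proof -
  have "concordant_filter X (RO_at X x)" using dV_X assms by (simp add: dV_space_def)
  then have "\<And>U. U \<in> RO_at X x \<Longrightarrow> \<exists>W\<in>RO_at X x. W \<lless> U" by (simp add: concordant_filter_def)
  then show "round_filter (RO_at X x)"
    using assms by (intro round_filterI) (auto simp: RO_at_def Int_regular)
qed (simp add: RO_at_def)

text \<open>A round filter is its own round part, so the dV-axiom about arbitrary filters turns it
  into a point.\<close>

lemma proper_round_filter_RO_at:
  assumes "round_filter F" "{} \<notin> F" obtains x where "x \<in> topspace X" "F = RO_at X x"
proof -
  have "RO_filter X F"
    unfolding RO_filter_def using assms round_filter_subset topspace_mem_round_filter Int_mem_round_filter round_filter_upward by (intro conjI ballI impI) auto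
  then obtain x where x: "x \<in> topspace X" "{U \<in> F. \<exists>W\<in>F. W \<lless> U} = RO_at X x"
    using dV_X unfolding dV_space_def by blast
  moreover have "{U \<in> F. \<exists>W\<in>F. W \<lless> U} = F" using round_filter_much_below[OF assms(1)] by blast
  ultimately show ?thesis using that by simp
qed

lemma regular_open_base:
  assumes "openin X U" "x \<in> U" obtains V where "V \<in> RO" "x \<in> V" "V \<subseteq> U"
proof -
  have "(arbitrary union_of (\<lambda>U. U \<in> RO)) U" using assms dV_X by (simp add: dV_space_def)
  then obtain \<U> where "\<U> \<subseteq> RO" "\<Union>\<U> = U" unfolding union_of_def by auto
  then show ?thesis using that assms(2) by blast
qed

lemma RO_at_bij: "bij_betw (RO_at X) (topspace X) (carrier filter_frame - {\<top>\<^bsub>filter_frame\<^esub>})"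
  unfolding bij_betw_def
proof
  show "inj_on (RO_at X) (topspace X)"
  proof (rule inj_onI, rule ccontr)
    fix x y assume xy: "x \<in> topspace X" "y \<in> topspace X" "RO_at X x = RO_at X y" "x \<noteq> y"
    have "t0_space X" using dV_X by (simp add: dV_space_def)
    then obtain U where U: "openin X U" "x \<notin> U \<longleftrightarrow> y \<in> U"
      using xy(1,2,4) unfolding t0_space_def by meson
    have "x \<in> U \<longleftrightarrow> y \<in> U"
    proof
      assume "x \<in> U"
      with U(1) obtain V where "V \<in> RO" "x \<in> V" "V \<subseteq> U" by (rule regular_open_base)
      then show "y \<in> U" using xy(3) by (auto simp: RO_at_def)
    next
      assume "y \<in> U"
      with U(1) obtain V where "V \<in> RO" "y \<in> V" "V \<subseteq> U" by (rule regular_open_base)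
      then show "x \<in> U" using xy(3) by (auto simp: RO_at_def)
    qed
    then show False using U by blast
  qed
  show "RO_at X ` topspace X = carrier filter_frame - {\<top>\<^bsub>filter_frame\<^esub>}"
  proof (intro subset_antisym subsetI)
    fix F assume "F \<in> RO_at X ` topspace X"
    then show "F \<in> carrier filter_frame - {\<top>\<^bsub>filter_frame\<^esub>}"
      using RO_at_round empty_regular[of X] by (auto simp: top_filter_frame simp del: empty_regular)
  next
    fix F assume "F \<in> carrier filter_frame - {\<top>\<^bsub>filter_frame\<^esub>}"
    then have "round_filter F" "{} \<notin> F" using round_filter_eq_RO_iff by (auto simp: top_filter_frame)
    then obtain x where "x \<in> topspace X" "F = RO_at X x" by (rule proper_round_filter_RO_at)
    then show "F \<in> RO_at X ` topspace X" by simp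
  qed
qed

text \<open>Joining to the top means having disjoint members, and \<open>perp X U\<close> is the
  largest regular open set disjoint from \<open>U\<close>. So the box of \<open>F\<close> pulls back
  to a union of open sets.\<close>

lemma RO_at_mem_box_iff:
  assumes "round_filter F" "x \<in> topspace X"
  shows "RO_at X x \<in> box filter_frame F \<longleftrightarrow> (\<exists>U\<in>F. x \<in> perp X U)"
proof -
  have "RO_at X x \<noteq> RO" using RO_at_round(2)[OF assms(2)] empty_regular[of X] by metis
  then have "RO_at X x \<in> carrier filter_frame - {\<top>\<^bsub>filter_frame\<^esub>}"
    using RO_at_round(1)[OF assms(2)] by (simp add: top_filter_frame)
  then have "RO_at X x \<in> box filter_frame F \<longleftrightarrow> (\<exists>U\<in>F. \<exists>V\<in>RO_at X x. U \<inter> V = {})"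
    using assms RO_at_round by (simp add: box_def join_eq_top_iff)
  also have "\<dots> \<longleftrightarrow> (\<exists>U\<in>F. x \<in> perp X U)"
  proof -
    have "(\<exists>V\<in>RO_at X x. U \<inter> V = {}) \<longleftrightarrow> x \<in> perp X U" if "U \<in> F" for U
    proof
      assume "\<exists>V\<in>RO_at X x. U \<inter> V = {}"
      then obtain V where "V \<in> RO" "x \<in> V" "V \<inter> U = {}" by (auto simp: RO_at_def)
      then show "x \<in> perp X U" using subset_perp[of X V U] regular_open_openin by auto
    next
      assume "x \<in> perp X U"
      moreover have "perp X U \<in> RO"
        using that round_filter_regular[OF assms(1)] by (simp add: perp_regular regular_open_openin)
      ultimately show "\<exists>V\<in>RO_at X x. U \<inter> V = {}"
        using disjoint_perp[of U X] by (intro bexI[of _ "perp X U"]) (simp_all add: RO_at_def)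
    qed
    then show ?thesis by simp
  qed
  finally show ?thesis .
qed

lemma openin_RO_at_vimage_box:
  assumes "round_filter F" shows "openin X {x \<in> topspace X. RO_at X x \<in> box filter_frame F}"
proof -
  have "{x \<in> topspace X. RO_at X x \<in> box filter_frame F} = (\<Union>U\<in>F. perp X U)"
    using RO_at_mem_box_iff[OF assms] perp_subset_topspace[of X] by blast
  then show ?thesis by (auto intro: openin_Union)
qed

text \<open>By contraposition, \<open>perp X V \<lless> U\<close> becomes
  \<open>perp X U \<lless> V\<close>, so the chosen filter's box pulls back to a union of sets much
  below \<open>V\<close>. Concordance of \<open>RO_at X x\<close> shows that they exhaust
  \<open>V\<close>.\<close>

lemma regular_open_vimage_box:
  assumes "V \<in> RO"
  shows "\<exists>F. round_filter F \<and> {x \<in> topspace X. RO_at X x \<in> box filter_frame F} = V"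
proof -
  let ?F = "{U \<in> RO. perp X V \<lless> U}"
  have pV: "perp X V \<in> RO" using assms by (simp add: perp_regular regular_open_openin)
  then have F: "round_filter ?F" by (rule round_filter_above)
  have "(\<exists>U\<in>?F. x \<in> perp X U) \<longleftrightarrow> x \<in> V" if x: "x \<in> topspace X" for x
  proof
    assume "\<exists>U\<in>?F. x \<in> perp X U"
    then obtain U where U: "U \<in> RO" "perp X V \<lless> U" "x \<in> perp X U" by blast
    have "perp X U \<lless> perp X (perp X V)" by (rule much_below_perp[OF pV U(1,2)])
    then have "perp X U \<subseteq> V"
      using much_below_subset[of "perp X U" V] U assms
      by (simp add: regular_open_perp_perp perp_regular regular_open_openin)
    then show "x \<in> V" using U by blast
  next
    assume "x \<in> V"
    then have "V \<in> RO_at X x" using assms by (simp add: RO_at_def)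
    then obtain W where W: "W \<in> RO_at X x" "W \<lless> V" using round_filter_much_below[OF RO_at_round(1)[OF x]] by blast
    then have "W \<in> RO" "x \<in> W" by (simp_all add: RO_at_def)
    then have "perp X W \<in> ?F" "x \<in> perp X (perp X W)"
      using W assms much_below_perp[of W V]
      by (simp_all add: perp_regular regular_open_openin regular_open_perp_perp)
    then show "\<exists>U\<in>?F. x \<in> perp X U" by blast
  qed
  then have "{x \<in> topspace X. RO_at X x \<in> box filter_frame ?F} = V"
    using RO_at_mem_box_iff[OF F] regular_open_subset[OF assms] by blast
  then show ?thesis using F by blast
qed

end

section \<open>The representation theorem\<close>

context frame
begin

text \<open>That \<open>S\<close> consists of elements other than \<open>\<top>\<close> is implied,
  since boxes contain no others.\<close>

lemma openin_upper_Vietoris: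
  "openin (upper_Vietoris L) S \<longleftrightarrow> (\<forall>c\<in>S. \<exists>a\<in>carrier L. c \<in> box L a \<and> box L a \<subseteq> S)"
proof
  assume "openin (upper_Vietoris L) S"
  then have "generate_topology_on (box L ` carrier L) S"
    by (simp add: upper_Vietoris_def openin_topology_generated_by_iff)
  then show "\<forall>c\<in>S. \<exists>a\<in>carrier L. c \<in> box L a \<and> box L a \<subseteq> S"
  proof induction
    case (Int S T)
    show ?case
    proof
      fix c assume "c \<in> S \<inter> T"
      then obtain a b where "a \<in> carrier L" "c \<in> box L a" "box L a \<subseteq> S"
        "b \<in> carrier L" "c \<in> box L b" "box L b \<subseteq> T" using Int.IH by blast
      then show "\<exists>a\<in>carrier L. c \<in> box L a \<and> box L a \<subseteq> S \<inter> T"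
        by (intro bexI[of _ "a \<sqinter> b"]) (auto simp: box_meet)
    qed
  next
    case (UN K)
    show ?case
    proof
      fix c assume "c \<in> \<Union>K"
      then obtain k where k: "k \<in> K" "c \<in> k" by blast
      then obtain a where "a \<in> carrier L" "c \<in> box L a" "box L a \<subseteq> k" using UN.IH by blast
      then show "\<exists>a\<in>carrier L. c \<in> box L a \<and> box L a \<subseteq> \<Union>K" using k by blast
    qed
  qed auto
next
  assume S: "\<forall>c\<in>S. \<exists>a\<in>carrier L. c \<in> box L a \<and> box L a \<subseteq> S"
  show "openin (upper_Vietoris L) S"
  proof (subst openin_subopen, intro ballI)
    fix c assume "c \<in> S"
    then obtain a where a: "a \<in> carrier L" "c \<in> box L a" "box L a \<subseteq> S" using S by auto
    then have "openin (upper_Vietoris L) (box L a)"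
      unfolding upper_Vietoris_def by (intro topology_generated_by_Basis) simp
    then show "\<exists>T. openin (upper_Vietoris L) T \<and> c \<in> T \<and> T \<subseteq> S" using a by auto
  qed
qed

lemma topspace_upper_Vietoris: "topspace (upper_Vietoris L) = carrier L - {\<top>}"
proof -
  have "box L \<top> = carrier L - {\<top>}" by (auto simp: box_def)
  then show ?thesis
    by (auto simp: upper_Vietoris_def box_def)
qed

end

lemma (in compact_regular_locale) dV_space_if_homeomorphic:
  assumes "X homeomorphic_space upper_Vietoris L"
  shows "dV_space X"
proof -
  obtain f where f: "homeomorphic_map X (upper_Vietoris L) f"
    using assms homeomorphic_space by blast
  have surj: "f ` topspace X = carrier L - {\<top>}"
    using homeomorphic_imp_surjective_map[OF f] by (simp add: topspace_upper_Vietoris)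
  have inj: "inj_on f (topspace X)" using f by (simp add: homeomorphic_map_def)
  have box_sub: "box L a \<subseteq> f ` U \<longleftrightarrow> topspace X \<inter> f -` box L a \<subseteq> U" if U: "U \<subseteq> topspace X" for a U
  proof
    assume H: "box L a \<subseteq> f ` U"
    show "topspace X \<inter> f -` box L a \<subseteq> U"
    proof
      fix x assume x: "x \<in> topspace X \<inter> f -` box L a"
      then obtain y where "y \<in> U" "f x = f y" using H by blast
      then show "x \<in> U" using inj_onD[OF inj] x U by blast
    qed
  next
    assume H: "topspace X \<inter> f -` box L a \<subseteq> U"
    have "box L a \<subseteq> f ` topspace X" using surj by (auto simp: box_def)
    then show "box L a \<subseteq> f ` U" using H by blast
  qed
  have "openin X U \<longleftrightarrow> U \<subseteq> topspace X \<and>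
      (\<forall>x\<in>U. \<exists>a\<in>carrier L. f x \<in> box L a \<and> topspace X \<inter> f -` box L a \<subseteq> U)" for U
  proof (cases "U \<subseteq> topspace X")
    case True
    then have "openin X U \<longleftrightarrow> openin (upper_Vietoris L) (f ` U)"
      using homeomorphic_map_openness[OF f] by simp
    then show ?thesis using box_sub[OF True] True by (simp add: openin_upper_Vietoris)
  qed (use openin_subset[of X U] in auto)
  then interpret Vietoris_model L X f
    using surj inj by unfold_locales (simp_all add: bij_betw_def)
  show ?thesis by (rule dV_space_X)
qed

context dV_topology
begin

lemma homeomorphic_upper_Vietoris: "X homeomorphic_space upper_Vietoris filter_frame"
proof -
  interpret FL: frame filter_frame by (rule frame_filter_frame)
  let ?f = "RO_at X"
  have surj: "?f ` topspace X = topspace (upper_Vietoris filter_frame)" and inj: "inj_on ?f (topspace X)"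
    using RO_at_bij by (simp_all add: bij_betw_def FL.topspace_upper_Vietoris)
  have "openin X {x \<in> topspace X. ?f x \<in> S} \<longleftrightarrow> openin (upper_Vietoris filter_frame) S"
    if S: "S \<subseteq> topspace (upper_Vietoris filter_frame)" for S
  proof
    assume V: "openin X {x \<in> topspace X. ?f x \<in> S}"
    show "openin (upper_Vietoris filter_frame) S"
      unfolding FL.openin_upper_Vietoris
    proof
      fix c assume "c \<in> S"
      moreover from this obtain x where x: "x \<in> topspace X" "c = ?f x" using S surj by blast
      ultimately have "x \<in> {x \<in> topspace X. ?f x \<in> S}" by simp
      with V obtain W where W: "W \<in> RO" "x \<in> W" "W \<subseteq> {x \<in> topspace X. ?f x \<in> S}"
        by (rule regular_open_base)
      then obtain F where F: "round_filter F" "{x \<in> topspace X. ?f x \<in> box filter_frame F} = W"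
        using regular_open_vimage_box by blast
      have "box filter_frame F \<subseteq> S"
      proof
        fix d assume d: "d \<in> box filter_frame F"
        then have "d \<in> ?f ` topspace X" unfolding surj FL.topspace_upper_Vietoris by (simp add: box_def)
        then obtain y where "y \<in> topspace X" "d = ?f y" by blast
        then show "d \<in> S" using F W d by blast
      qed
      moreover have "c \<in> box filter_frame F" using F W x by blast
      ultimately show "\<exists>a\<in>carrier filter_frame. c \<in> box filter_frame a \<and> box filter_frame a \<subseteq> S"
        using F(1) by (intro bexI[of _ F]) simp_all
    qed
  next
    assume O: "openin (upper_Vietoris filter_frame) S"
    show "openin X {x \<in> topspace X. ?f x \<in> S}"
    proof (subst openin_subopen, intro ballI)
      fix x assume x: "x \<in> {x \<in> topspace X. ?f x \<in> S}"
      then obtain F where F: "round_filter F" "?f x \<in> box filter_frame F" "box filter_frame F \<subseteq> S"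
        using O unfolding FL.openin_upper_Vietoris by auto
      show "\<exists>T. openin X T \<and> x \<in> T \<and> T \<subseteq> {x \<in> topspace X. ?f x \<in> S}"
        using openin_RO_at_vimage_box[OF F(1)] F x
        by (intro exI[of _ "{x \<in> topspace X. ?f x \<in> box filter_frame F}"]) auto
    qed
  qed
  \<comment> \<open>An injective quotient map is a homeomorphism, so comparing open sets through
    preimages is enough.\<close>
  then have "homeomorphic_map X (upper_Vietoris filter_frame) ?f"
    unfolding homeomorphic_map_def quotient_map_def using surj inj by simp
  then show ?thesis using homeomorphic_space by blast
qed

end

text \<open>An existential cannot range over types, so its locale has the type of
  \<open>filter_frame\<close>; the second conjunct covers locales whose elements have an arbitrary
  type \<open>'b\<close>.\<close>

theorem theorem6p5:
  fixes X :: "'a topology"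
  shows "(dV_space X \<longleftrightarrow>
            (\<exists>L :: 'a set set gorder. compact_regular_locale L \<and> X homeomorphic_space upper_Vietoris L)) \<and>
         (\<forall>L :: 'b gorder. compact_regular_locale L \<and> X homeomorphic_space upper_Vietoris L
            \<longrightarrow> dV_space X)"
proof (intro conjI iffI allI impI)
  assume "dV_space X"
  then interpret dV_topology X by unfold_locales
  show "\<exists>L :: 'a set set gorder. compact_regular_locale L \<and> X homeomorphic_space upper_Vietoris L"
    using compact_regular_filter_frame homeomorphic_upper_Vietoris by blast
next
  assume "\<exists>L :: 'a set set gorder. compact_regular_locale L \<and> X homeomorphic_space upper_Vietoris L"
  then obtain L :: "'a set set gorder"
    where "compact_regular_locale L" "X homeomorphic_space upper_Vietoris L" by (elim exE conjE)
  then show "dV_space X" by (rule compact_regular_locale.dV_space_if_homeomorphic)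
next
  fix L :: "'b gorder"
  assume "compact_regular_locale L \<and> X homeomorphic_space upper_Vietoris L"
  then show "dV_space X" using compact_regular_locale.dV_space_if_homeomorphic by (elim conjE)
qed

end
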